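(* Let $G$ be a connected finite simple undirected graph. The toric ideal $I_G$ is unimodular if and only if exactly one of the following holds: ($\alpha$) all blocks of $G$ are bipartite; ($\beta$) all blocks of $G$ are bipartite except exactly one, and this one non-bipartite block has the strong odd cycle property; ($\gamma$) all blocks of $G$ are bipartite except $s$ blocks for some $s\geq 2$, and $G$ has a link vertex $x$.
   Context: The toric ideal $I_G$ of a graph $G$ with edges $e_1,\dots,e_m$ is the toric ideal of the set of columns of the vertex-edge incidence matrix $A_G$ of $G$ (the $0/1$ matrix with rows indexed by vertices, columns indexed by edges, and entry $1$ exactly when the vertex is an endpoint of the edge). An integer matrix $A$ of rank $d$ is called unimodular if all non-zero $d\times d$ minors of $A$ have the same absolute value. The toric ideal $I_G$ is called unimodular if the matrix $A_G$ is unimodular. A cut vertex is a vertex whose removal increases the number of connected components. A graph is biconnected if it is connected and has no cut vertex; a block of $G$ is a maximal biconnected subgraph of $G$ (a cut edge together with its two endpoints is a block). A graph has the strong odd cycle property if any two of its odd cycles intersect, i.e. share at least one vertex. A vertex $v$ of $G$ is a link vertex of $G$ if every odd cycle of $G$ passes through $v$. *)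

theory Defs
  imports
    "Jordan_Normal_Form.DL_Rank"
    "Jordan_Normal_Form.DL_Submatrix"
begin

section \<open>Finite simple graphs\<close>

record 'a ugraph =
  verts :: "'a set"
  edges :: "'a set set"

definition finite_simple_graph :: "'a ugraph \<Rightarrow> bool" where
  "finite_simple_graph G \<longleftrightarrow>
     finite (verts G) \<and> (\<forall>e\<in>edges G. e \<subseteq> verts G \<and> card e = 2)"

text \<open>Subgraphs need not be induced.\<close>

definition subgraph :: "'a ugraph \<Rightarrow> 'a ugraph \<Rightarrow> bool" where
  "subgraph H G \<longleftrightarrow>
     verts H \<subseteq> verts G \<and> edges H \<subseteq> edges G \<and> (\<forall>e\<in>edges H. e \<subseteq> verts H)"

definition adjacent :: "'a ugraph \<Rightarrow> 'a \<Rightarrow> 'a \<Rightarrow> bool" where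
  "adjacent G u v \<longleftrightarrow> {u, v} \<in> edges G"

definition components :: "'a ugraph \<Rightarrow> 'a set set" where
  "components G = (\<lambda>u. {v \<in> verts G. rtranclp (adjacent G) u v}) ` verts G"

text \<open>The graph without vertices has no component and hence is not connected.\<close>

definition connected_graph :: "'a ugraph \<Rightarrow> bool" where
  "connected_graph G \<longleftrightarrow> card (components G) = 1"

definition remove_vertex :: "'a ugraph \<Rightarrow> 'a \<Rightarrow> 'a ugraph" where
  "remove_vertex G v = \<lparr>verts = verts G - {v}, edges = {e \<in> edges G. v \<notin> e}\<rparr>"

definition cut_vertex :: "'a ugraph \<Rightarrow> 'a \<Rightarrow> bool" where
  "cut_vertex G v \<longleftrightarrow>
     v \<in> verts G \<and> card (components G) < card (components (remove_vertex G v))"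

definition biconnected :: "'a ugraph \<Rightarrow> bool" where
  "biconnected G \<longleftrightarrow> connected_graph G \<and> (\<nexists>v. cut_vertex G v)"

definition blocks :: "'a ugraph \<Rightarrow> 'a ugraph set" where
  "blocks G = {B. subgraph B G \<and> biconnected B \<and>
     (\<forall>H. subgraph H G \<and> biconnected H \<and> subgraph B H \<longrightarrow> H = B)}"

definition bipartite :: "'a ugraph \<Rightarrow> bool" where
  "bipartite G \<longleftrightarrow>
     (\<exists>X Y. X \<union> Y = verts G \<and> X \<inter> Y = {} \<and>
        (\<forall>e\<in>edges G. \<exists>x\<in>X. \<exists>y\<in>Y. e = {x, y}))"

text \<open>A cycle is given by the list of its pairwise distinct vertices in cyclic order.\<close>

definition is_cycle :: "'a ugraph \<Rightarrow> 'a list \<Rightarrow> bool" where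
  "is_cycle G c \<longleftrightarrow>
     3 \<le> length c \<and> distinct c \<and> set c \<subseteq> verts G \<and>
     (\<forall>i<length c. adjacent G (c ! i) (c ! (Suc i mod length c)))"

definition odd_cycle :: "'a ugraph \<Rightarrow> 'a list \<Rightarrow> bool" where
  "odd_cycle G c \<longleftrightarrow> is_cycle G c \<and> odd (length c)"

definition strong_odd_cycle_property :: "'a ugraph \<Rightarrow> bool" where
  "strong_odd_cycle_property G \<longleftrightarrow>
     (\<forall>c d. odd_cycle G c \<and> odd_cycle G d \<longrightarrow> set c \<inter> set d \<noteq> {})"

definition link_vertex :: "'a ugraph \<Rightarrow> 'a \<Rightarrow> bool" where
  "link_vertex G v \<longleftrightarrow> v \<in> verts G \<and> (\<forall>c. odd_cycle G c \<longrightarrow> v \<in> set c)"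


section \<open>Unimodularity\<close>

definition int_mat_rank :: "int mat \<Rightarrow> nat" where
  "int_mat_rank A = vec_space.rank (dim_row A) (map_mat rat_of_int A)"

definition minors :: "int mat \<Rightarrow> nat \<Rightarrow> int set" where
  "minors A d = {det (submatrix A I J) | I J.
     I \<subseteq> {..<dim_row A} \<and> J \<subseteq> {..<dim_col A} \<and> card I = d \<and> card J = d}"

definition unimodular :: "int mat \<Rightarrow> bool" where
  "unimodular A \<longleftrightarrow>
     (\<forall>p\<in>minors A (int_mat_rank A). \<forall>q\<in>minors A (int_mat_rank A).
        p \<noteq> 0 \<and> q \<noteq> 0 \<longrightarrow> \<bar>p\<bar> = \<bar>q\<bar>)"

text \<open>The list \<open>vs\<close> enumerates the vertices (rows), \<open>es\<close> the edges (columns).\<close>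

definition incidence_matrix :: "'a list \<Rightarrow> 'a set list \<Rightarrow> int mat" where
  "incidence_matrix vs es =
     mat (length vs) (length es) (\<lambda>(i, j). if vs ! i \<in> es ! j then 1 else 0)"

text \<open>
  Unimodularity of the toric ideal of a graph is by definition unimodularity of the incidence
  matrix that defines the ideal, here the one for the enumerations \<open>vs\<close> and \<open>es\<close>.
\<close>

definition toric_ideal_unimodular :: "'a list \<Rightarrow> 'a set list \<Rightarrow> bool" where
  "toric_ideal_unimodular vs es \<longleftrightarrow> unimodular (incidence_matrix vs es)"


definition exactly_one_of :: "bool \<Rightarrow> bool \<Rightarrow> bool \<Rightarrow> bool" where
  "exactly_one_of P Q R \<longleftrightarrow>
     (P \<and> \<not> Q \<and> \<not> R) \<or> (\<not> P \<and> Q \<and> \<not> R) \<or> (\<not> P \<and> \<not> Q \<and> R)"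

end

theory Submission
  imports Defs "Jordan_Normal_Form.DL_Rank_Submatrix"
begin

text \<open>
  Both sides are equivalent to the strong odd cycle property of the whole graph \<open>G\<close>.

  Every odd cycle lies in a block, and every non-bipartite block contains one, so only the case of
  at least two non-bipartite blocks needs an argument. Two odd cycles in different blocks meet in
  the unique common vertex \<open>x\<close> of these blocks. An odd cycle avoiding \<open>x\<close> would meet both of them,
  and its block would form a triangle of blocks with the other two; but the union of such a
  triangle is biconnected.

  A bipartite incidence matrix is totally unimodular. If \<open>G\<close> is connected and not bipartite, the
  incidence matrix has full row rank. The edge set of a nonsingular maximal minor has an odd cycle
  in each component, so under the strong odd cycle property it is connected; writing an edge of \<open>G\<close>
  as the alternating sum of an odd walk between its endpoints shows that all columns are integer
  combinations of the columns of that minor, and hence nonzero maximal minors divide each other.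
  Conversely, two disjoint odd cycles give a partition of the vertices into two parts such that the
  edges within the parts still have full rank. By Cramer's rule, unimodularity would make
  an edge between the parts an integer combination of edges within the parts, which is impossible
  by parity.
\<close>

section \<open>Walks and odd cycles\<close>

text \<open>The flag is \<open>True\<close> when the number of steps is odd; only this parity
  matters for two-colourings and for signs in alternating sums. The edge set is a bare parameter
  because walks are also taken in sets of selected columns.\<close>

inductive parity_walk :: "'a set set \<Rightarrow> bool \<Rightarrow> 'a \<Rightarrow> 'a \<Rightarrow> bool" for E where
  refl: "parity_walk E False u u"
| step: "parity_walk E p u v \<Longrightarrow> {v, w} \<in> E \<Longrightarrow> parity_walk E (\<not> p) u w"

lemma parity_walk_edge: "{u, v} \<in> E \<Longrightarrow> parity_walk E True u v"
  using parity_walk.step[OF parity_walk.refl] by fastforce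

lemma parity_walk_trans:
  assumes "parity_walk E q v w" "parity_walk E p u v"
  shows "parity_walk E (p \<noteq> q) u w"
  using assms
proof (induction rule: parity_walk.induct)
  case (step q v w x)
  then have "parity_walk E (\<not> (p \<noteq> q)) u x"
    using parity_walk.step by fastforce
  moreover have "(\<not> (p \<noteq> q)) = (p \<noteq> (\<not> q))" by auto
  ultimately show ?case by metis
qed simp

lemma parity_walk_sym:
  assumes "parity_walk E p u v"
  shows "parity_walk E p v u"
  using assms
proof (induction rule: parity_walk.induct)
  case (step p u v w)
  then have "parity_walk E True w v"
    by (intro parity_walk_edge) (simp add: insert_commute)
  from parity_walk_trans[OF step.IH this] show ?case by simp
qed (rule parity_walk.refl)

lemma parity_walk_mono: "parity_walk E p u v \<Longrightarrow> E \<subseteq> F \<Longrightarrow> parity_walk F p u v"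
  by (induction rule: parity_walk.induct) (auto intro: parity_walk.intros)

lemma rtranclp_adjacent_iff_parity_walk:
  "rtranclp (adjacent G) u v \<longleftrightarrow> (\<exists>p. parity_walk (edges G) p u v)"
proof
  show "\<exists>p. parity_walk (edges G) p u v" if "rtranclp (adjacent G) u v"
    using that
    by (induction rule: rtranclp_induct) (auto simp: adjacent_def intro: parity_walk.intros)
next
  assume "\<exists>p. parity_walk (edges G) p u v"
  then obtain p where "parity_walk (edges G) p u v" ..
  then show "rtranclp (adjacent G) u v"
    by (induction rule: parity_walk.induct)
      (auto simp: adjacent_def intro: rtranclp.rtrancl_into_rtrancl)
qed

section \<open>Extraction of an odd cycle from an odd closed walk\<close>

lemma parity_walk_imp_list:
  assumes "parity_walk E p u v"
  shows "\<exists>xs. xs \<noteq> [] \<and> hd xs = u \<and> last xs = v \<and> successively (\<lambda>a b. {a, b} \<in> E) xs \<and>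
    (even (length xs) \<longleftrightarrow> p) \<and> (\<forall>w\<in>set xs. \<exists>q. parity_walk E q u w)"
  using assms
proof (induction rule: parity_walk.induct)
  case (refl u)
  show ?case by (rule exI[of _ "[u]"]) (auto intro: parity_walk.refl)
next
  case (step p u v w)
  then obtain xs where "xs \<noteq> []" "hd xs = u" "last xs = v" "successively (\<lambda>a b. {a, b} \<in> E) xs"
    "even (length xs) \<longleftrightarrow> p" "\<forall>w\<in>set xs. \<exists>q. parity_walk E q u w" by blast
  moreover have "parity_walk E (\<not> p) u w" using step by (blast intro: parity_walk.step)
  ultimately show ?case
    using step.hyps by (intro exI[of _ "xs @ [w]"]) (auto simp: successively_append_iff)
qed

text \<open>The list \<open>xs\<close> omits the final return to its head, so its length is the
  number of edges. A repeated vertex splits the closed walk into two shorter ones whose lengths add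
  up to that of \<open>xs\<close>, so one of them is odd.\<close>

lemma odd_closed_walk_contains_odd_cycle:
  assumes "\<forall>e\<in>edges G. e \<subseteq> verts G \<and> card e = 2"
    and "successively (\<lambda>a b. {a, b} \<in> edges G) (xs @ [hd xs])" "odd (length xs)"
  shows "\<exists>c. odd_cycle G c \<and> set c \<subseteq> set xs"
  using assms(2,3)
proof (induction xs rule: length_induct)
  case (1 xs)
  let ?S = "successively (\<lambda>a b. {a, b} \<in> edges G)"
  show ?case
  proof (cases "distinct xs")
    case True
    have adj: "adjacent G (xs ! i) (xs ! (Suc i mod length xs))" if "i < length xs" for i
    proof -
      have "xs ! (Suc i mod length xs) = (xs @ [hd xs]) ! Suc i"
        using that by (cases "Suc i = length xs"; cases xs) (auto simp: nth_append)
      moreover have "xs ! i = (xs @ [hd xs]) ! i" using that by (simp add: nth_append)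
      ultimately show ?thesis
        using 1(2) that by (auto simp: successively_conv_nth adjacent_def)
    qed
    \<comment> \<open>Length 1 would be a loop, which \<open>card e = 2\<close> excludes.\<close>
    have "length xs \<noteq> 1"
    proof
      assume l: "length xs = 1"
      then have "adjacent G (xs ! 0) (xs ! 0)" using adj[of 0] by simp
      then show False using assms(1) by (fastforce simp: adjacent_def)
    qed
    then have "3 \<le> length xs" using 1(3) by presburger
    moreover have "set xs \<subseteq> verts G"
      using adj assms(1) by (fastforce simp: adjacent_def in_set_conv_nth)
    ultimately show ?thesis
      using True adj 1(3) by (auto simp: odd_cycle_def is_cycle_def)
  next
    case False
    then obtain as bs cs x where xs: "xs = as @ [x] @ bs @ [x] @ cs"
      using not_distinct_decomp by blast
    \<comment> \<open>\<open>?y\<close> is the detour from \<open>x\<close> back to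
      \<open>x\<close>, and \<open>?z\<close> is the walk with this detour cut out.\<close>
    let ?y = "x # bs" and ?z = "as @ x # cs"
    have y: "?S (?y @ [hd ?y])"
    proof -
      have "?S (as @ (?y @ [hd ?y]) @ (cs @ [hd xs]))" using 1(2) xs by simp
      then show ?thesis unfolding successively_append_iff by blast
    qed
    have z: "?S (?z @ [hd ?z])"
    proof -
      have "?S ((as @ [x]) @ bs @ ([x] @ cs @ [hd xs]))" using 1(2) xs by simp
      then have "?S (as @ [x])" "?S ([x] @ cs @ [hd xs])" unfolding successively_append_iff by blast+
      then have "?S (as @ [x] @ cs @ [hd xs])" by (auto simp: successively_append_iff)
      moreover have "hd ?z = hd xs" using xs by (cases as) auto
      ultimately show ?thesis by simp
    qed
    have "odd (length ?y) \<or> odd (length ?z)" using 1(3) xs by auto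
    then obtain ys where "?S (ys @ [hd ys])" "odd (length ys)" "length ys < length xs" "set ys \<subseteq> set xs"
    proof
      assume "odd (length ?y)"
      with y xs show ?thesis by (intro that[of ?y]) auto
    next
      assume "odd (length ?z)"
      with z xs show ?thesis by (intro that[of ?z]) auto
    qed
    then show ?thesis using 1(1) by blast
  qed
qed

lemma parity_walk_contains_odd_cycle:
  assumes "\<forall>e\<in>edges G. e \<subseteq> verts G \<and> card e = 2" "parity_walk (edges G) True r r"
  shows "\<exists>c. odd_cycle G c \<and> (\<forall>w\<in>set c. \<exists>q. parity_walk (edges G) q r w)"
proof -
  obtain xs where xs: "xs \<noteq> []" "hd xs = r" "last xs = r"
    "successively (\<lambda>a b. {a, b} \<in> edges G) xs" "even (length xs)"
    "\<forall>w\<in>set xs. \<exists>q. parity_walk (edges G) q r w"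
    using parity_walk_imp_list[OF assms(2)] by blast
  \<comment> \<open>The list \<open>xs\<close> names \<open>r\<close> at both ends; without the
    second occurrence its length is the odd number of edges.\<close>
  define ys where "ys = butlast xs"
  have xys: "xs = ys @ [r]" using xs unfolding ys_def by (metis append_butlast_last_id)
  with xs(5) have "ys \<noteq> []" by auto
  then have "hd ys = r" using xys xs(2) by auto
  then obtain c where "odd_cycle G c" "set c \<subseteq> set ys"
    using odd_closed_walk_contains_odd_cycle[OF assms(1), of ys] xs(4,5) xys by auto
  with xs(6) xys show ?thesis by auto
qed

section \<open>Rotation of cycles, and cycles as closed walks\<close>

lemma is_cycle_rotate:
  assumes "is_cycle G c"
  shows "is_cycle G (rotate i c)"
  unfolding is_cycle_def
proof (intro conjI allI impI)
  fix k assume k: "k < length (rotate i c)"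
  let ?n = "length c"
  have n: "0 < ?n" using assms by (auto simp: is_cycle_def)
  have "rotate i c ! k = c ! ((i + k) mod ?n)" using k by (simp add: nth_rotate add.commute)
  moreover have "rotate i c ! (Suc k mod ?n) = c ! (Suc ((i + k) mod ?n) mod ?n)"
    using n mod_less_divisor[of ?n "Suc k"] by (simp add: nth_rotate mod_simps del: mod_less_divisor)
  moreover have "adjacent G (c ! ((i + k) mod ?n)) (c ! (Suc ((i + k) mod ?n) mod ?n))"
    using assms n by (simp add: is_cycle_def)
  ultimately show "adjacent G (rotate i c ! k) (rotate i c ! (Suc k mod length (rotate i c)))"
    by simp
qed (use assms in \<open>auto simp: is_cycle_def\<close>)

lemma is_cycle_rotate_to:
  assumes "is_cycle G c" "v \<in> set c"
  obtains d where "is_cycle G (v # d)" "set (v # d) = set c" "length (v # d) = length c"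
proof -
  obtain i where i: "i < length c" "c ! i = v" using assms(2) by (auto simp: in_set_conv_nth)
  have "rotate i c ! 0 = v" using i by (subst nth_rotate) auto
  moreover have "rotate i c \<noteq> []" using i by auto
  ultimately obtain d where "rotate i c = v # d" by (cases "rotate i c") auto
  then show thesis
    using that is_cycle_rotate[OF assms(1), of i] by (metis set_rotate length_rotate)
qed

lemma successively_parity_walk:
  assumes "successively (\<lambda>a b. {a, b} \<in> E) xs" "xs \<noteq> []"
  shows "parity_walk E (even (length xs)) (hd xs) (last xs)"
  using assms
proof (induction xs rule: rev_induct)
  case (snoc x xs)
  show ?case
  proof (cases "xs = []")
    case True
    then show ?thesis by (auto intro: parity_walk.refl)
  next
    case False
    with snoc have "parity_walk E (even (length xs)) (hd xs) (last xs)" "{last xs, x} \<in> E"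
      by (auto simp: successively_append_iff)
    from parity_walk.step[OF this] False show ?thesis by simp
  qed
qed simp

text \<open>\<open>E\<close> is kept apart from \<open>edges G\<close> so that the cycle can be
  traversed inside a restricted edge set.\<close>

lemma odd_cycle_parity_walk:
  assumes "odd_cycle G c" "u \<in> set c" "\<And>a b. {a, b} \<in> edges G \<Longrightarrow> a \<in> set c \<Longrightarrow> b \<in> set c \<Longrightarrow> {a, b} \<in> E"
  shows "parity_walk E True u u"
proof -
  obtain d where d: "is_cycle G (u # d)" "set (u # d) = set c" "length (u # d) = length c"
    using is_cycle_rotate_to assms(1,2) unfolding odd_cycle_def by metis
  have "successively (\<lambda>a b. {a, b} \<in> E) ((u # d) @ [u])"
    unfolding successively_conv_nth
  proof (intro allI impI)
    fix i assume i: "Suc i < length ((u # d) @ [u])"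
    then have "((u # d) @ [u]) ! Suc i = (u # d) ! (Suc i mod length (u # d))"
      by (cases "i = length d") (auto simp: nth_append)
    moreover have "((u # d) @ [u]) ! i = (u # d) ! i"
      using i by (auto simp: nth_append nth_Cons split: nat.split)
    moreover have "{(u # d) ! i, (u # d) ! (Suc i mod length (u # d))} \<in> edges G"
      using d(1) i by (auto simp: is_cycle_def adjacent_def)
    moreover have "(u # d) ! k \<in> set c" if "k < length (u # d)" for k
      using that d(2) nth_mem by blast
    moreover have "i < length (u # d)" "Suc i mod length (u # d) < length (u # d)"
      using i by auto
    ultimately show "{((u # d) @ [u]) ! i, ((u # d) @ [u]) ! Suc i} \<in> E"
      using assms(3) by simp
  qed
  from successively_parity_walk[OF this] have "parity_walk E (odd (length (u # d))) u u" by simp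
  then show ?thesis
    using assms(1) unfolding d(3) odd_cycle_def by simp
qed

text \<open>Every step changes sides, so a bipartite graph has no odd closed walk. Conversely, a
  vertex is coloured by the parity of a walk from a root of its component; an ambiguous colour would
  give an odd closed walk, hence an odd cycle.\<close>

lemma bipartite_iff_no_odd_cycle:
  assumes "\<forall>e\<in>edges G. e \<subseteq> verts G \<and> card e = 2"
  shows "bipartite G \<longleftrightarrow> (\<nexists>c. odd_cycle G c)"
proof
  assume "bipartite G"
  then obtain X Y where XY: "X \<union> Y = verts G" "X \<inter> Y = {}"
    "\<forall>e\<in>edges G. \<exists>x\<in>X. \<exists>y\<in>Y. e = {x, y}" by (auto simp: bipartite_def)
  have flip: "(v \<in> X) = ((u \<in> X) \<noteq> p)" if "parity_walk (edges G) p u v" for p u v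
    using that
  proof (induction rule: parity_walk.induct)
    case (step p u v w)
    obtain x y where "x \<in> X" "y \<in> Y" "{v, w} = {x, y}" using XY(3) step(2) by blast
    then have "(v \<in> X) \<noteq> (w \<in> X)" using XY(2) by (auto simp: doubleton_eq_iff)
    then show ?case using step by auto
  qed simp
  show "\<nexists>c. odd_cycle G c"
  proof
    assume "\<exists>c. odd_cycle G c"
    then obtain c where c: "odd_cycle G c" ..
    then obtain u where "u \<in> set c" by (cases c) (auto simp: odd_cycle_def)
    with flip odd_cycle_parity_walk[OF c] show False by blast
  qed
next
  let ?W = "parity_walk (edges G)"
  assume no: "\<nexists>c. odd_cycle G c"
  \<comment> \<open>The predicates under \<open>SOME\<close> agree for all vertices of a component,
    so these vertices receive literally the same root.\<close>
  define rt where "rt v = (SOME r. \<exists>p. ?W p v r)" for v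
  have rt: "\<exists>p. ?W p (rt v) v" for v
  proof -
    have "\<exists>p. ?W p v (rt v)"
      unfolding rt_def by (rule someI_ex) (blast intro: parity_walk.refl)
    then show ?thesis by (blast intro: parity_walk_sym)
  qed
  have odd_closed: "\<not> ?W True r r" for r
    using parity_walk_contains_odd_cycle[OF assms] no by blast
  define X where "X = {v \<in> verts G. ?W False (rt v) v}"
  have edge: "\<exists>x\<in>X. \<exists>y\<in>verts G - X. e = {x, y}" if e: "e \<in> edges G" for e
  proof -
    obtain u v where uv: "e = {u, v}" "u \<in> verts G" "v \<in> verts G"
      using assms e by (metis card_2_iff insert_subset)
    have W: "?W True u v" "?W True v u"
      using e uv(1) by (auto intro: parity_walk_edge simp: insert_commute)
    have "(\<exists>p. ?W p u r) \<longleftrightarrow> (\<exists>p. ?W p v r)" for r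
      using W by (meson parity_walk_trans)
    then have rt_eq: "rt u = rt v" by (simp add: rt_def)
    have "?W (\<not> p) (rt v) v" if "?W p (rt v) u" for p
      using parity_walk_trans[OF W(1) that] by (cases p) auto
    moreover have "?W (\<not> p) (rt v) u" if "?W p (rt v) v" for p
      using parity_walk_trans[OF W(2) that] by (cases p) auto
    moreover have "\<not> (?W True (rt v) w \<and> ?W False (rt v) w)" for w
      using odd_closed
        parity_walk_trans[OF parity_walk_sym, of "edges G" True "rt v" w False "rt v"] by auto
    moreover obtain p where "?W p (rt v) v" using rt by blast
    ultimately have "?W False (rt v) u \<longleftrightarrow> \<not> ?W False (rt v) v"
      by (cases p) (metis (full_types))+
    then have "(u \<in> X) \<noteq> (v \<in> X)"
      using uv by (simp add: X_def rt_eq)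
    then show ?thesis using uv by (auto simp: insert_commute)
  qed
  show "bipartite G"
    unfolding bipartite_def
    by (rule exI[of _ X], rule exI[of _ "verts G - X"]) (use edge in \<open>auto simp: X_def\<close>)
qed


section \<open>Blocks\<close>

text \<open>Connectedness in a form that also admits the graph without vertices, which is what
  remains when the vertex of a one-vertex graph is removed.\<close>

definition linked :: "'a ugraph \<Rightarrow> bool" where
  "linked G \<longleftrightarrow> (\<forall>u\<in>verts G. \<forall>v\<in>verts G. rtranclp (adjacent G) u v)"

lemma adjacent_rtranclp_sym: "rtranclp (adjacent G) u v \<Longrightarrow> rtranclp (adjacent G) v u"
  by (auto simp: rtranclp_adjacent_iff_parity_walk intro: parity_walk_sym)

lemma card_components_le_1_iff:
  assumes "finite (verts G)"
  shows "card (components G) \<le> 1 \<longleftrightarrow> linked G"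
proof
  assume "card (components G) \<le> 1"
  moreover have "finite (components G)" using assms by (simp add: components_def)
  ultimately have eq: "X = Y" if "X \<in> components G" "Y \<in> components G" for X Y
    using that card_le_Suc0_iff_eq[of "components G"] by simp
  show "linked G"
    unfolding linked_def
  proof (intro ballI)
    fix u v assume uv: "u \<in> verts G" "v \<in> verts G"
    then have "{w \<in> verts G. rtranclp (adjacent G) u w} = {w \<in> verts G. rtranclp (adjacent G) v w}"
      by (intro eq) (auto simp: components_def)
    with uv show "rtranclp (adjacent G) u v" by auto
  qed
next
  assume "linked G"
  then have "components G \<subseteq> {verts G}" by (auto simp: linked_def components_def)
  then show "card (components G) \<le> 1" using card_mono[of "{verts G}" "components G"] by simp
qed

lemma connected_graph_iff:
  assumes "finite (verts G)"
  shows "connected_graph G \<longleftrightarrow> verts G \<noteq> {} \<and> linked G"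
proof -
  have "card (components G) = 0 \<longleftrightarrow> verts G = {}"
    using assms by (simp add: components_def)
  then show ?thesis
    unfolding connected_graph_def card_components_le_1_iff[OF assms, symmetric] by linarith
qed

text \<open>A connected graph has one component, so the count increases exactly when the remainder
  is not \<open>linked\<close>. A \<open>v\<close> outside the graph leaves it unchanged, hence the
  quantifier over all \<open>v\<close>.\<close>

lemma biconnected_iff:
  assumes "finite (verts G)" "\<forall>e\<in>edges G. e \<subseteq> verts G"
  shows "biconnected G \<longleftrightarrow> verts G \<noteq> {} \<and> linked G \<and> (\<forall>v. linked (remove_vertex G v))"
proof (cases "connected_graph G")
  case True
  have fin: "finite (verts (remove_vertex G v))" for v
    using assms(1) by (simp add: remove_vertex_def)
  have same: "remove_vertex G v = G" if "v \<notin> verts G" for v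
    using that assms(2) by (cases G) (auto simp: remove_vertex_def)
  have "cut_vertex G v \<longleftrightarrow> v \<in> verts G \<and> \<not> linked (remove_vertex G v)" for v
    using True unfolding cut_vertex_def card_components_le_1_iff[OF fin, symmetric]
    by (auto simp: connected_graph_def)
  then show ?thesis
    using True connected_graph_iff[OF assms(1)] same unfolding biconnected_def by metis
qed (auto simp: biconnected_def connected_graph_iff[OF assms(1)])

section \<open>Unions of overlapping graphs\<close>

definition graph_union :: "'a ugraph \<Rightarrow> 'a ugraph \<Rightarrow> 'a ugraph" where
  "graph_union G H = \<lparr>verts = verts G \<union> verts H, edges = edges G \<union> edges H\<rparr>"

lemma linked_graph_union:
  assumes "linked G" "linked H" "x \<in> verts G" "x \<in> verts H"
  shows "linked (graph_union G H)"
proof -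
  have "rtranclp (adjacent (graph_union G H)) u v"
    if "rtranclp (adjacent G) u v \<or> rtranclp (adjacent H) u v" for u v
    using that unfolding rtranclp_adjacent_iff_parity_walk
    by (auto simp: graph_union_def intro: parity_walk_mono)
  then have x: "rtranclp (adjacent (graph_union G H)) u x" if "u \<in> verts (graph_union G H)" for u
    using that assms by (auto simp: graph_union_def linked_def)
  show ?thesis
    unfolding linked_def using x adjacent_rtranclp_sym[OF x] by (blast intro: rtranclp_trans)
qed

lemma remove_vertex_graph_union:
  "remove_vertex (graph_union G H) v = graph_union (remove_vertex G v) (remove_vertex H v)"
  by (auto simp: remove_vertex_def graph_union_def)

lemma subgraph_graph_union:
  "subgraph H G \<Longrightarrow> subgraph K G \<Longrightarrow> subgraph (graph_union H K) G"
  by (fastforce simp: subgraph_def graph_union_def)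

lemma subgraph_trans: "subgraph K H \<Longrightarrow> subgraph H G \<Longrightarrow> subgraph K G"
  by (auto simp: subgraph_def)

section \<open>Blocks containing a given biconnected subgraph or cycle\<close>

locale simple_graph =
  fixes G :: "'a ugraph"
  assumes fin_simple: "finite_simple_graph G"
begin

lemma finite_verts: "finite (verts G)"
  using fin_simple by (simp add: finite_simple_graph_def)

lemma edge_simple: "\<forall>e\<in>edges G. e \<subseteq> verts G \<and> card e = 2"
  using fin_simple by (simp add: finite_simple_graph_def)

lemma finite_edges: "finite (edges G)"
  using edge_simple finite_verts by (meson Pow_iff finite_Pow_iff finite_subset subsetI)

lemma subgraph_edge_simple: "subgraph H G \<Longrightarrow> \<forall>e\<in>edges H. e \<subseteq> verts H \<and> card e = 2"
  using edge_simple by (auto simp: subgraph_def)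

lemma subgraph_finite: "subgraph H G \<Longrightarrow> finite (verts H) \<and> finite (edges H)"
  using finite_verts finite_edges by (auto simp: subgraph_def intro: finite_subset)

lemma subgraph_biconnected_iff:
  "subgraph H G \<Longrightarrow> biconnected H \<longleftrightarrow> verts H \<noteq> {} \<and> linked H \<and> (\<forall>v. linked (remove_vertex H v))"
  using biconnected_iff subgraph_finite subgraph_edge_simple by blast

text \<open>Among the biconnected subgraphs containing \<open>H\<close>, one with the largest number
  of vertices plus edges is maximal, since a proper extension would increase one of the two
  counts.\<close>

lemma biconnected_subset_block:
  assumes "subgraph H G" "biconnected H"
  obtains B where "B \<in> blocks G" "subgraph H B"
proof -
  let ?P = "\<lambda>K. subgraph K G \<and> biconnected K \<and> subgraph H K"
  let ?f = "\<lambda>K :: 'a ugraph. card (verts K) + card (edges K)"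
  have "?P H" using assms by (auto simp: subgraph_def)
  moreover have "?f K < Suc (?f G)" if "?P K" for K
    using that finite_verts finite_edges
    by (auto simp: subgraph_def less_Suc_eq_le intro!: add_mono card_mono)
  ultimately obtain B where B: "?P B" "\<And>K. ?P K \<Longrightarrow> ?f K \<le> ?f B"
    using ex_has_greatest_nat[of ?P H ?f "Suc (?f G)"] by blast
  have "K = B" if K: "subgraph K G" "biconnected K" "subgraph B K" for K
  proof -
    have "?P K" using K B(1) subgraph_trans by blast
    then have "?f K \<le> ?f B" by (rule B(2))
    moreover have sub: "verts B \<subseteq> verts K" "edges B \<subseteq> edges K" using K(3) by (auto simp: subgraph_def)
    moreover have fin: "finite (verts K)" "finite (edges K)" using subgraph_finite[OF K(1)] by auto
    moreover have "card (verts B) \<le> card (verts K)" "card (edges B) \<le> card (edges K)"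
      using sub fin by (auto intro: card_mono)
    ultimately have "card (verts B) = card (verts K)" "card (edges B) = card (edges K)"
      by linarith+
    with sub fin have "verts B = verts K" "edges B = edges K"
      using card_subset_eq by blast+
    then show ?thesis by simp
  qed
  with B(1) have "B \<in> blocks G" by (auto simp: blocks_def)
  with B(1) that show thesis by blast
qed

text \<open>The subgraph \<open>H\<close> induced on the vertices of the cycle is biconnected:
  rotated to start at a deleted vertex, the cycle leaves a path through all other vertices. A block
  containing \<open>H\<close> contains the cycle.\<close>

lemma cycle_in_block:
  assumes "is_cycle G c"
  obtains B where "B \<in> blocks G" "is_cycle B c"
proof -
  define H where "H = \<lparr>verts = set c, edges = {e \<in> edges G. e \<subseteq> set c}\<rparr>"
  have H: "subgraph H G" using assms by (auto simp: H_def subgraph_def is_cycle_def)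
  have cH: "is_cycle H c"
    unfolding is_cycle_def
  proof (intro conjI allI impI)
    fix i assume i: "i < length c"
    then have "c ! (Suc i mod length c) \<in> set c" by (intro nth_mem mod_less_divisor) auto
    then show "adjacent H (c ! i) (c ! (Suc i mod length c))"
      using i assms by (auto simp: H_def is_cycle_def adjacent_def)
  qed (use assms in \<open>auto simp: is_cycle_def H_def\<close>)
  \<comment> \<open>Vertices listed along one walk reach each other through its head.\<close>
  have path: "rtranclp (adjacent K) u v"
    if "successively (\<lambda>a b. {a, b} \<in> edges K) xs" "u \<in> set xs" "v \<in> set xs" for K :: "'a ugraph" and xs u v
  proof -
    have "rtranclp (adjacent K) (hd xs) w" if "w \<in> set xs" for w
    proof -
      obtain ys zs where xs: "xs = ys @ [w] @ zs" using \<open>w \<in> set xs\<close> by (metis split_list append_Cons append_Nil)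
      then have "successively (\<lambda>a b. {a, b} \<in> edges K) (ys @ [w])"
        using \<open>successively _ xs\<close> by (auto simp: successively_append_iff)
      from successively_parity_walk[OF this] show ?thesis
        unfolding rtranclp_adjacent_iff_parity_walk xs by (cases ys) auto
    qed
    with that(2,3) show ?thesis by (blast intro: rtranclp_trans adjacent_rtranclp_sym)
  qed
  have succ: "successively (\<lambda>a b. {a, b} \<in> edges H) d" if "is_cycle H d" for d
    using that unfolding successively_conv_nth is_cycle_def adjacent_def
    by (metis Suc_lessD mod_less)
  have "linked H"
    unfolding linked_def using path[OF succ[OF cH]] by (simp add: H_def)
  moreover have "linked (remove_vertex H v)" for v
  proof (cases "v \<in> set c")
    case True
    then obtain d where d: "is_cycle H (v # d)" "set (v # d) = set c"
      using is_cycle_rotate_to[OF cH] by metis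
    have "distinct (v # d)" using d(1) by (simp add: is_cycle_def)
    then have vd: "verts (remove_vertex H v) = set d" using d(2) by (auto simp: remove_vertex_def H_def)
    have "successively (\<lambda>a b. {a, b} \<in> edges H) d"
      using succ[OF d(1)] by (auto simp: successively_Cons)
    then have "successively (\<lambda>a b. {a, b} \<in> edges (remove_vertex H v)) d"
      by (rule successively_mono) (use \<open>distinct (v # d)\<close> in \<open>auto simp: remove_vertex_def\<close>)
    from path[OF this] show ?thesis unfolding linked_def vd by blast
  next
    case False
    then have "remove_vertex H v = H" by (auto simp: remove_vertex_def H_def)
    with \<open>linked H\<close> show ?thesis by simp
  qed
  moreover have "verts H \<noteq> {}" using assms by (auto simp: H_def is_cycle_def)
  ultimately have "biconnected H" using subgraph_biconnected_iff[OF H] by blast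
  then obtain B where B: "B \<in> blocks G" "subgraph H B" using biconnected_subset_block[OF H] by blast
  with cH have "is_cycle B c" by (auto simp: is_cycle_def subgraph_def adjacent_def)
  with B(1) that show thesis by blast
qed

lemma finite_blocks: "finite (blocks G)"
proof (rule finite_subset)
  show "blocks G \<subseteq> (\<lambda>(V, E). \<lparr>verts = V, edges = E\<rparr>) ` (Pow (verts G) \<times> Pow (edges G))"
  proof
    fix B assume "B \<in> blocks G"
    then have "B = (\<lambda>(V, E). \<lparr>verts = V, edges = E\<rparr>) (verts B, edges B)"
      "(verts B, edges B) \<in> Pow (verts G) \<times> Pow (edges G)"
      by (auto simp: blocks_def subgraph_def)
    then show "B \<in> (\<lambda>(V, E). \<lparr>verts = V, edges = E\<rparr>) ` (Pow (verts G) \<times> Pow (edges G))"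
      by (rule image_eqI)
  qed
qed (use finite_verts finite_edges in auto)

lemma blockD:
  assumes "B \<in> blocks G"
  shows "subgraph B G" "linked B" "linked (remove_vertex B v)"
    and "subgraph H G \<Longrightarrow> biconnected H \<Longrightarrow> subgraph B H \<Longrightarrow> H = B"
  using assms subgraph_biconnected_iff[of B] by (auto simp: blocks_def)

lemma nonbipartite_block_iff:
  assumes "B \<in> blocks G"
  shows "\<not> bipartite B \<longleftrightarrow> (\<exists>c. odd_cycle B c)"
  using bipartite_iff_no_odd_cycle[OF subgraph_edge_simple[OF blockD(1)[OF assms]]] by blast

lemma odd_cycle_block_imp:
  assumes "B \<in> blocks G" "odd_cycle B c"
  shows "odd_cycle G c" "set c \<subseteq> verts B"
  using assms blockD(1)[OF assms(1)]
  by (auto simp: odd_cycle_def is_cycle_def subgraph_def adjacent_def)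

section \<open>Intersections of blocks and the link vertex\<close>

lemma block_eqI:
  assumes "B \<in> blocks G" "C \<in> blocks G" "subgraph K G" "biconnected K" "subgraph B K" "subgraph C K"
  shows "B = C"
  using assms blockD(4) by metis

text \<open>With two common vertices, deleting any vertex leaves one that still joins the two
  blocks. Their union would then be biconnected, against maximality.\<close>

lemma blocks_share_le_1:
  assumes B: "B \<in> blocks G" and C: "C \<in> blocks G"
    and x: "x \<in> verts B" "x \<in> verts C" and y: "y \<in> verts B" "y \<in> verts C" and "B \<noteq> C"
  shows "x = y"
proof (rule ccontr)
  assume "x \<noteq> y"
  let ?U = "graph_union B C"
  have sub: "subgraph ?U G" using B C by (intro subgraph_graph_union blockD)
  have "linked (remove_vertex ?U v)" for v
  proof -
    obtain z where "z \<noteq> v" "z \<in> verts B" "z \<in> verts C" using x y \<open>x \<noteq> y\<close> by metis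
    then show ?thesis
      unfolding remove_vertex_graph_union using B C
      by (intro linked_graph_union[of _ _ z] blockD) (auto simp: remove_vertex_def)
  qed
  moreover have "linked ?U" using B C x by (intro linked_graph_union[of _ _ x] blockD)
  ultimately have "biconnected ?U"
    using subgraph_biconnected_iff[OF sub] x by (auto simp: graph_union_def)
  moreover have "subgraph B ?U" "subgraph C ?U"
    using subgraph_edge_simple[OF blockD(1)[OF B]] subgraph_edge_simple[OF blockD(1)[OF C]]
    by (auto simp: subgraph_def graph_union_def)
  ultimately show False using block_eqI[OF B C sub] \<open>B \<noteq> C\<close> by blast
qed

text \<open>The union of the three blocks would be biconnected. Without \<open>x\<close>, the chain
  \<open>B\<close>, \<open>D\<close>, \<open>C\<close> holds together at \<open>z\<close> and
  \<open>y\<close>; without another vertex, \<open>B\<close> and \<open>C\<close> meet at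
  \<open>x\<close>, and \<open>D\<close> is attached at whichever of \<open>y\<close> and
  \<open>z\<close> is left. \<open>D\<close> may coincide with \<open>B\<close> or
  \<open>C\<close>.\<close>

lemma blocks_triangle:
  assumes B: "B \<in> blocks G" and C: "C \<in> blocks G" and D: "D \<in> blocks G" and "B \<noteq> C"
    and x: "x \<in> verts B" "x \<in> verts C" and y: "y \<in> verts C" "y \<in> verts D"
    and z: "z \<in> verts B" "z \<in> verts D"
    and "x \<noteq> y" "y \<noteq> z" "x \<noteq> z"
  shows False
proof -
  let ?U = "graph_union (graph_union B C) D"
  have sub: "subgraph ?U G" using B C D by (intro subgraph_graph_union blockD)
  let ?r = "\<lambda>H v. remove_vertex H v"
  have vr: "u \<in> verts (?r H v) \<longleftrightarrow> u \<in> verts H \<and> u \<noteq> v" for u v and H :: "'a ugraph"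
    by (auto simp: remove_vertex_def)
  have vU: "u \<in> verts (graph_union H K) \<longleftrightarrow> u \<in> verts H \<or> u \<in> verts K" for u and H K :: "'a ugraph"
    by (auto simp: graph_union_def)
  have "linked (remove_vertex ?U v)" for v
  proof (cases "v = x")
    case True
    have "linked (graph_union (?r B v) (?r D v))"
      by (rule linked_graph_union[of _ _ z]) (use blockD(3) z True assms in \<open>auto simp: vr\<close>)
    then have "linked (graph_union (graph_union (?r B v) (?r D v)) (?r C v))"
      by (rule linked_graph_union[of _ _ y]) (use blockD(3) y True assms in \<open>auto simp: vr vU\<close>)
    moreover have "graph_union (graph_union (?r B v) (?r D v)) (?r C v) = remove_vertex ?U v"
      unfolding remove_vertex_graph_union by (auto simp: graph_union_def)
    ultimately show ?thesis by simp
  next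
    case False
    have *: "linked (graph_union (?r B v) (?r C v))"
      by (rule linked_graph_union[of _ _ x]) (use blockD(3) x False assms in \<open>auto simp: vr\<close>)
    obtain w where "w \<noteq> v" "w \<in> verts D" "w \<in> verts B \<or> w \<in> verts C"
      using y z \<open>y \<noteq> z\<close> by metis
    then show ?thesis
      unfolding remove_vertex_graph_union
      by (intro linked_graph_union[OF *, of _ w]) (use blockD(3) D in \<open>auto simp: vr vU\<close>)
  qed
  moreover have "linked ?U"
    by (rule linked_graph_union[of _ _ y], rule linked_graph_union[of _ _ x])
      (use blockD(2) x y B C D in \<open>auto simp: vU\<close>)
  ultimately have "biconnected ?U"
    using subgraph_biconnected_iff[OF sub] x by (auto simp: graph_union_def)
  moreover have "subgraph B ?U" "subgraph C ?U"
    using subgraph_edge_simple[OF blockD(1)[OF B]] subgraph_edge_simple[OF blockD(1)[OF C]]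
    by (auto simp: subgraph_def graph_union_def)
  ultimately show False using block_eqI[OF B C sub] \<open>B \<noteq> C\<close> by blast
qed

lemma link_vertex_if_two_nonbipartite_blocks:
  assumes socp: "strong_odd_cycle_property G"
    and B: "B \<in> blocks G" "\<not> bipartite B" and C: "C \<in> blocks G" "\<not> bipartite C" and "B \<noteq> C"
  shows "\<exists>x. link_vertex G x"
proof -
  have meet: "set c \<inter> set d \<noteq> {}" if "odd_cycle G c" "odd_cycle G d" for c d
    using socp that by (auto simp: strong_odd_cycle_property_def)
  obtain b c where b: "odd_cycle B b" and c: "odd_cycle C c"
    using B C nonbipartite_block_iff by blast
  note bG = odd_cycle_block_imp[OF B(1) b] and cG = odd_cycle_block_imp[OF C(1) c]
  obtain x where x: "x \<in> set b" "x \<in> set c" using meet bG cG by blast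
  have "x \<in> set d" if d: "odd_cycle G d" for d
  proof (rule ccontr)
    assume nx: "x \<notin> set d"
    obtain D where D: "D \<in> blocks G" "is_cycle D d"
      using d cycle_in_block unfolding odd_cycle_def by blast
    then have "odd_cycle D d" using d by (simp add: odd_cycle_def)
    note dG = odd_cycle_block_imp[OF D(1) this]
    obtain y where y: "y \<in> set c" "y \<in> set d" using meet cG dG by blast
    obtain z where z: "z \<in> set b" "z \<in> set d" using meet bG dG by blast
    have "x \<noteq> y" "x \<noteq> z" using y z nx by auto
    \<comment> \<open>Otherwise \<open>y\<close> would be a second common vertex of \<open>B\<close>
      and \<open>C\<close>.\<close>
    moreover have "y \<noteq> z"
      using blocks_share_le_1[OF B(1) C(1), of x y] x y z bG cG \<open>B \<noteq> C\<close> \<open>x \<noteq> y\<close> by blast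
    ultimately show False
      using blocks_triangle[OF B(1) C(1) D(1) \<open>B \<noteq> C\<close>, of x y z] x y z bG cG dG by blast
  qed
  moreover have "x \<in> verts G" using x bG by (auto simp: odd_cycle_def is_cycle_def)
  ultimately show ?thesis by (auto simp: link_vertex_def)
qed

text \<open>The number of non-bipartite blocks, being 0, 1 or at least 2, already decides which
  single alternative can hold. It remains to match that alternative with the property of
  \<open>G\<close>.\<close>

lemma strong_odd_cycle_property_iff_blocks:
  "strong_odd_cycle_property G \<longleftrightarrow>
    exactly_one_of
      (\<forall>B\<in>blocks G. bipartite B)
      (\<exists>B\<in>blocks G. \<not> bipartite B \<and> (\<forall>B'\<in>blocks G. B' \<noteq> B \<longrightarrow> bipartite B') \<and>
         strong_odd_cycle_property B)
      (\<exists>s\<ge>2. card {B \<in> blocks G. \<not> bipartite B} = s \<and> (\<exists>x. link_vertex G x))"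
  (is "_ \<longleftrightarrow> exactly_one_of ?\<alpha> ?\<beta> ?\<gamma>")
proof -
  let ?N = "{B \<in> blocks G. \<not> bipartite B}"
  have fin: "finite ?N" using finite_blocks by simp
  have cyc: "\<exists>B\<in>?N. odd_cycle B c" if c: "odd_cycle G c" for c
  proof -
    obtain B where "B \<in> blocks G" "is_cycle B c"
      using c cycle_in_block unfolding odd_cycle_def by blast
    then show ?thesis using c nonbipartite_block_iff by (auto simp: odd_cycle_def)
  qed
  consider "?N = {}" | B where "?N = {B}" | B C where "B \<in> ?N" "C \<in> ?N" "B \<noteq> C" by blast
  then show ?thesis
  proof cases
    case 1
    then have "\<nexists>c. odd_cycle G c" using cyc by blast
    then have "strong_odd_cycle_property G" by (auto simp: strong_odd_cycle_property_def)
    moreover have ?\<alpha> using 1 by blast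
    moreover have "\<not> ?\<beta>" using 1 by blast
    moreover have "\<not> ?\<gamma>" unfolding 1 by simp
    ultimately show ?thesis by (simp add: exactly_one_of_def)
  next
    case (2 B)
    have "odd_cycle G c \<longleftrightarrow> odd_cycle B c" for c
      using cyc[of c] odd_cycle_block_imp(1)[of B c] unfolding 2 using 2 by auto
    then have socp: "strong_odd_cycle_property G \<longleftrightarrow> strong_odd_cycle_property B"
      by (simp add: strong_odd_cycle_property_def)
    have B: "B \<in> blocks G" "\<not> bipartite B" "\<And>B'. B' \<in> blocks G \<Longrightarrow> B' \<noteq> B \<Longrightarrow> bipartite B'"
      using 2 by blast+
    then have "?\<beta> \<longleftrightarrow> strong_odd_cycle_property B" "\<not> ?\<alpha>" by blast+
    moreover have "\<not> ?\<gamma>" unfolding 2 by simp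
    ultimately show ?thesis using socp unfolding exactly_one_of_def by argo
  next
    case (3 B C)
    have "card {B, C} \<le> card ?N" using 3 fin by (intro card_mono) auto
    then have "?\<gamma> \<longleftrightarrow> (\<exists>x. link_vertex G x)" using 3 by simp
    moreover have "strong_odd_cycle_property G \<longleftrightarrow> (\<exists>x. link_vertex G x)"
      using link_vertex_if_two_nonbipartite_blocks[of B C] 3
      by (auto simp: link_vertex_def strong_odd_cycle_property_def)
    moreover have "\<not> ?\<alpha>" using 3 by blast
    moreover have "\<not> ?\<beta>"
    proof
      assume ?\<beta>
      then obtain B0 where "\<And>B'. B' \<in> blocks G \<Longrightarrow> B' \<noteq> B0 \<Longrightarrow> bipartite B'" by blast
      from this[of B] this[of C] 3 show False by blast
    qed
    ultimately show ?thesis unfolding exactly_one_of_def by argo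
  qed
qed

end

section \<open>Determinants\<close>

lemma det_zero_if_left_kernel:
  fixes M :: "'a :: idom mat"
  assumes M: "M \<in> carrier_mat n n" and "\<And>j. j < n \<Longrightarrow> (\<Sum>i<n. y i * M $$ (i, j)) = 0"
    and "i < n" "y i \<noteq> 0"
  shows "det M = 0"
proof -
  have "vec n y \<noteq> 0\<^sub>v n"
  proof
    assume "vec n y = 0\<^sub>v n"
    then have "vec n y $ i = 0\<^sub>v n $ i" by simp
    with assms(3,4) show False by simp
  qed
  moreover have "M\<^sup>T *\<^sub>v vec n y = 0\<^sub>v n"
    using assms(1,2) by (intro eq_vecI) (auto simp: scalar_prod_def lessThan_atLeast0 mult.commute)
  ultimately have "det (M\<^sup>T) = 0"
    using M by (subst det_0_iff_vec_prod_zero[of _ n]) (auto intro!: exI[of _ "vec n y"])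
  then show ?thesis using det_transpose[OF M] by simp
qed

text \<open>The rows are coloured by \<open>t\<close>, and a column has at most one 1 in each
  colour. If some column has its ones in a single colour, it has at most one, and Laplace expansion
  reduces the size. Otherwise every column has exactly one 1 of each colour, so the rows with signs
  given by the colours add up to zero.\<close>

lemma abs_det_le_1_if_two_coloured:
  fixes M :: "int mat" and t :: "nat \<Rightarrow> bool"
  assumes "M \<in> carrier_mat n n"
    and "\<And>i j. i < n \<Longrightarrow> j < n \<Longrightarrow> M $$ (i, j) \<in> {0, 1}"
    and "\<And>i i' j. i < n \<Longrightarrow> i' < n \<Longrightarrow> j < n \<Longrightarrow> M $$ (i, j) \<noteq> 0 \<Longrightarrow> M $$ (i', j) \<noteq> 0 \<Longrightarrow>
      t i = t i' \<Longrightarrow> i = i'"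
  shows "\<bar>det M\<bar> \<le> 1"
  using assms
proof (induction n arbitrary: M t)
  case 0
  then show ?case by simp
next
  case (Suc n)
  show ?case
  proof (cases "\<exists>j<Suc n. \<exists>b. \<forall>i<Suc n. M $$ (i, j) \<noteq> 0 \<longrightarrow> t i = b")
    case True
    then obtain j b where j: "j < Suc n" and b: "\<forall>i<Suc n. M $$ (i, j) \<noteq> 0 \<longrightarrow> t i = b" by blast
    have expand: "det M = (\<Sum>i<Suc n. M $$ (i, j) * cofactor M i j)"
      by (rule laplace_expansion_column[OF Suc.prems(1) j])
    show ?thesis
    proof (cases "\<exists>i<Suc n. M $$ (i, j) \<noteq> 0")
      case False
      then show ?thesis unfolding expand by simp
    next
      case True
      then obtain i where i: "i < Suc n" "M $$ (i, j) \<noteq> 0" by blast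
      have "M $$ (k, j) = 0" if "k < Suc n" "k \<noteq> i" for k
        using that i b j Suc.prems(3)[of k i j] by auto
      then have "det M = (\<Sum>k<Suc n. if k = i then M $$ (i, j) * cofactor M i j else 0)"
        unfolding expand by (intro sum.cong) auto
      also have "\<dots> = cofactor M i j" using i j Suc.prems(2)[of i j] by (simp add: sum.delta)
      finally have "\<bar>det M\<bar> = \<bar>det (mat_delete M i j)\<bar>"
        by (simp add: cofactor_def abs_mult power_abs)
      moreover have "\<bar>det (mat_delete M i j)\<bar> \<le> 1"
      proof (rule Suc.IH)
        show "mat_delete M i j \<in> carrier_mat n n"
          using Suc.prems(1) by (auto simp: mat_delete_def)
        have entry: "mat_delete M i j $$ (k, l) = M $$ (insert_index i k, insert_index j l)"
          if "k < n" "l < n" for k l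
          using that Suc.prems(1) by (auto simp: mat_delete_def insert_index_def)
        have less: "insert_index m k < Suc n" if "k < n" for m k
          using that by (auto simp: insert_index_def)
        show "mat_delete M i j $$ (k, l) \<in> {0, 1}" if "k < n" "l < n" for k l
          using that Suc.prems(2) less by (simp add: entry)
        fix k k' l
        assume "k < n" "k' < n" "l < n" "mat_delete M i j $$ (k, l) \<noteq> 0" "mat_delete M i j $$ (k', l) \<noteq> 0"
          and "t (insert_index i k) = t (insert_index i k')"
        then have "insert_index i k = insert_index i k'"
          using Suc.prems(3)[of "insert_index i k" "insert_index i k'" "insert_index j l"] less
          by (simp add: entry)
        then show "k = k'" by (metis delete_insert_index)
      qed
      ultimately show ?thesis by simp
    qed
  next
    case False
    define y :: "nat \<Rightarrow> int" where "y i = (if t i then 1 else -1)" for i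
    have "(\<Sum>i<Suc n. y i * M $$ (i, j)) = 0" if j: "j < Suc n" for j
    proof -
      obtain p q where p: "p < Suc n" "M $$ (p, j) \<noteq> 0" "t p"
        and q: "q < Suc n" "M $$ (q, j) \<noteq> 0" "\<not> t q"
        using False j by metis
      have "M $$ (i, j) = 0" if "i < Suc n" "i \<noteq> p" "i \<noteq> q" for i
        using that p q j Suc.prems(3)[of i p j] Suc.prems(3)[of i q j] by metis
      then have "(\<Sum>i<Suc n. y i * M $$ (i, j)) = (\<Sum>i\<in>{p, q}. y i * M $$ (i, j))"
        using p q by (intro sum.mono_neutral_right) auto
      also have "\<dots> = M $$ (p, j) - M $$ (q, j)"
      proof -
        have "p \<noteq> q" using p q by auto
        then show ?thesis using p q by (simp add: y_def)
      qed
      also have "\<dots> = 0" using p q j Suc.prems(2)[of p j] Suc.prems(2)[of q j] by auto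
      finally show ?thesis .
    qed
    then have "det M = 0"
      using det_zero_if_left_kernel[OF Suc.prems(1), of y 0] by (simp add: y_def)
    then show ?thesis by simp
  qed
qed

text \<open>The coefficients form a matrix \<open>X\<close> with \<open>N = M * X\<close>; that they
  lie in the ring itself is what yields divisibility.\<close>

lemma det_dvd_det_if_integer_combinations:
  fixes M N :: "'a :: comm_ring_1 mat"
  assumes M: "M \<in> carrier_mat n n" and N: "N \<in> carrier_mat n n"
    and "\<And>j. j < n \<Longrightarrow> \<exists>x. \<forall>i<n. N $$ (i, j) = (\<Sum>k<n. M $$ (i, k) * x k)"
  shows "det M dvd det N"
proof -
  obtain x where x: "\<And>i j. i < n \<Longrightarrow> j < n \<Longrightarrow> N $$ (i, j) = (\<Sum>k<n. M $$ (i, k) * x j k)"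
    using assms(3) by metis
  define X where "X = mat n n (\<lambda>(k, j). x j k)"
  have "N = M * X"
    using M N by (intro eq_matI) (auto simp: x X_def scalar_prod_def lessThan_atLeast0)
  then show ?thesis using det_mult[OF M, of X] by (simp add: X_def)
qed

text \<open>Cramer's rule with the denominator cleared: the determinants with a replaced column are
  the entries of \<open>adj_mat M *\<^sub>v b\<close>.\<close>

lemma cramer_integral:
  fixes M :: "'a :: comm_ring_1 mat"
  assumes M: "M \<in> carrier_mat n n" and b: "b \<in> carrier_vec n" and i: "i < n"
  shows "(\<Sum>k<n. M $$ (i, k) * det (replace_col M b k)) = det M * b $ i"
proof -
  have adj: "adj_mat M \<in> carrier_mat n n" "M * adj_mat M = det M \<cdot>\<^sub>m 1\<^sub>m n"
    using adj_mat[OF M] by auto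
  have rc: "det (replace_col M b k) = (adj_mat M *\<^sub>v b) $ k" if k: "k < n" for k
  proof -
    have R: "replace_col M b k \<in> carrier_mat n n" using M by (simp add: replace_col_def)
    \<comment> \<open>Cofactors along column \<open>k\<close> do not see that column, so replacing
      it does not change them.\<close>
    have "mat_delete (replace_col M b k) l k = mat_delete M l k" if "l < n" for l
      using M that k by (auto simp: mat_delete_def replace_col_def)
    then show ?thesis
      using M b k unfolding laplace_expansion_column[OF R k]
      by (auto simp: scalar_prod_def lessThan_atLeast0 adj_mat_def cofactor_def replace_col_def
          mult.commute intro!: sum.cong)
  qed
  have "(\<Sum>k<n. M $$ (i, k) * det (replace_col M b k)) = (M *\<^sub>v (adj_mat M *\<^sub>v b)) $ i"
    using M i adj(1) by (simp add: rc scalar_prod_def lessThan_atLeast0)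
  also have "M *\<^sub>v (adj_mat M *\<^sub>v b) = (det M \<cdot>\<^sub>m 1\<^sub>m n) *\<^sub>v b"
    using M adj b by (simp flip: assoc_mult_mat_vec)
  also have "\<dots> $ i = det M * b $ i" using b i by simp
  finally show ?thesis .
qed

text \<open>The Gram matrix of a spanning family is nonsingular, and by multilinearity its determinant
  is a combination of the determinants of the \<open>n\<close>-element selections.\<close>

lemma obtain_nonsingular_selection:
  fixes a :: "'b \<Rightarrow> int vec"
  assumes "finite S" and carrier: "\<And>k. k \<in> S \<Longrightarrow> a k \<in> carrier_vec n"
    and ker: "\<And>y. y \<in> carrier_vec n \<Longrightarrow> \<forall>k\<in>S. a k \<bullet> y = 0 \<Longrightarrow> y = 0\<^sub>v n"
  obtains f where "\<And>i. i < n \<Longrightarrow> f i \<in> S" "det (mat\<^sub>r n n (\<lambda>i. a (f i))) \<noteq> 0"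
proof -
  \<comment> \<open>In the multilinear expansion used below, selections are the identity outside
    \<open>{0..<n}\<close>. This forces natural numbers as indices, so \<open>S\<close> is
    enumerated.\<close>
  obtain m :: nat and e where e: "S = e ` {k. k < m}"
    using finite_imp_nat_seg_image_inj_on[OF \<open>finite S\<close>] by blast
  define T where "T = {k. k < m}"
  define b where "b = a \<circ> e"
  have T: "finite T" by (simp add: T_def)
  have bc: "b k \<in> carrier_vec n" if "k \<in> T" for k using that carrier e by (auto simp: T_def b_def)
  \<comment> \<open>The Gram matrix, with each row written as a sum of multiples of the vectors
    \<open>b k\<close> so that multilinearity in the rows applies.\<close>
  define B where "B = mat\<^sub>r n n (\<lambda>i. finsum_vec TYPE(int) n (\<lambda>k. (b k $ i) \<cdot>\<^sub>v b k) T)"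
  have B: "B \<in> carrier_mat n n" by (simp add: B_def)
  have cl: "(\<lambda>k. (b k $ i) \<cdot>\<^sub>v b k) \<in> T \<rightarrow> carrier_vec n" for i using bc by auto
  have entry: "B $$ (i, j) = (\<Sum>k\<in>T. b k $ i * b k $ j)" if "i < n" "j < n" for i j
    using that carrier_vecD[OF bc] unfolding B_def
    by (auto simp: index_finsum_vec[OF T that(2) cl] intro!: sum.cong)
  have "det B \<noteq> 0"
  proof
    assume "det B = 0"
    then obtain y where y: "y \<in> carrier_vec n" "y \<noteq> 0\<^sub>v n" "B *\<^sub>v y = 0\<^sub>v n"
      using det_0_iff_vec_prod_zero[OF B] by blast
    have dot: "b k \<bullet> y = (\<Sum>j<n. b k $ j * y $ j)" if "k \<in> T" for k
      using y(1) by (simp add: scalar_prod_def lessThan_atLeast0)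
    have "(B *\<^sub>v y) $ i = (\<Sum>j<n. \<Sum>k\<in>T. b k $ i * (b k $ j * y $ j))" if "i < n" for i
      using that y(1) B
      by (auto simp: scalar_prod_def lessThan_atLeast0 entry sum_distrib_right mult.assoc intro!: sum.cong)
    then have By: "(\<Sum>k\<in>T. b k $ i * (b k \<bullet> y)) = 0" if "i < n" for i
      using that y(3) dot by (subst (asm) sum.swap) (simp flip: sum_distrib_left)
    \<comment> \<open>The quadratic form of \<open>B\<close> at \<open>y\<close> is a sum of
      squares, so a kernel vector of \<open>B\<close> is orthogonal to every
      \<open>b k\<close>.\<close>
    have "(\<Sum>k\<in>T. (b k \<bullet> y)\<^sup>2) = (\<Sum>k\<in>T. \<Sum>i<n. y $ i * (b k $ i * (b k \<bullet> y)))"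
      using dot by (auto simp: power2_eq_square sum_distrib_right mult_ac intro!: sum.cong)
    also have "\<dots> = (\<Sum>i<n. y $ i * (\<Sum>k\<in>T. b k $ i * (b k \<bullet> y)))"
      by (subst sum.swap) (simp add: sum_distrib_left)
    also have "\<dots> = 0" using By by simp
    finally have "\<forall>k\<in>T. b k \<bullet> y = 0"
      using T by (simp add: sum_nonneg_eq_0_iff)
    then have "\<forall>k\<in>S. a k \<bullet> y = 0" using e by (auto simp: T_def b_def)
    with ker y show False by blast
  qed
  have "(\<lambda>i k. (b k $ i) \<cdot>\<^sub>v b k) \<in> {0..<n} \<rightarrow> T \<rightarrow> carrier_vec n" using bc by auto
  from det_linear_rows_sum[OF T this] \<open>det B \<noteq> 0\<close>
  have "(\<Sum>f | (\<forall>i\<in>{0..<n}. f i \<in> T) \<and> (\<forall>i. i \<notin> {0..<n} \<longrightarrow> f i = i).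
    det (mat\<^sub>r n n (\<lambda>i. (b (f i) $ i) \<cdot>\<^sub>v b (f i)))) \<noteq> 0"
    by (simp add: B_def)
  then obtain f where f: "\<forall>i\<in>{0..<n}. f i \<in> T" "det (mat\<^sub>r n n (\<lambda>i. (b (f i) $ i) \<cdot>\<^sub>v b (f i))) \<noteq> 0"
    using sum.not_neutral_contains_not_neutral by (smt (verit) mem_Collect_eq)
  have "(\<lambda>i. b (f i)) \<in> {0..<n} \<rightarrow> carrier_vec n" using f(1) bc by auto
  from det_rows_mul[OF this, of "\<lambda>i. b (f i) $ i"] f(2)
  have "det (mat\<^sub>r n n (\<lambda>i. b (f i))) \<noteq> 0" by auto
  with f(1) show thesis by (intro that[of "e \<circ> f"]) (auto simp: b_def e T_def)
qed

lemma (in vec_space) rank_le_nr: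
  assumes "A \<in> carrier_mat n nc"
  shows "rank A \<le> n"
proof -
  have "lin_indpt {}" by (simp add: lin_dep_def)
  then obtain S where S: "maximal S (\<lambda>T. T \<subseteq> set (cols A) \<and> lin_indpt T)"
    using maximal_exists_superset[of "set (cols A)" "\<lambda>T. T \<subseteq> set (cols A) \<and> lin_indpt T" "{}"] by auto
  then have "lin_indpt S" "S \<subseteq> carrier_vec n"
    using cols_dim[of A] assms by (auto simp: maximal_def)
  then have "card S \<le> n" using li_le_dim(2)[OF fin_dim] dim_is_n by simp
  with rank_card_indpt[OF assms S] show ?thesis by simp
qed


section \<open>Maximal minors of incidence matrices\<close>

text \<open>Columns are chosen by a function instead of an index set as in \<open>minors\<close>.
  Repetitions are allowed and give determinant 0; the order affects only the sign.\<close>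

definition edge_matrix :: "'a list \<Rightarrow> (nat \<Rightarrow> 'a set) \<Rightarrow> int mat" where
  "edge_matrix vs g = mat (length vs) (length vs) (\<lambda>(i, j). of_bool (vs ! i \<in> g j))"

lemma edge_matrix_carrier [simp]: "edge_matrix vs g \<in> carrier_mat (length vs) (length vs)"
  by (simp add: edge_matrix_def)

lemma edge_matrix_index [simp]:
  "i < length vs \<Longrightarrow> j < length vs \<Longrightarrow> edge_matrix vs g $$ (i, j) = of_bool (vs ! i \<in> g j)"
  by (simp add: edge_matrix_def)

lemma sum_nth_distinct:
  assumes "distinct vs"
  shows "(\<Sum>i<length vs. h (vs ! i)) = (\<Sum>v\<in>set vs. h v)"
  using assms by (intro sum.reindex_bij_betw bij_betw_nth) auto

lemma sum_of_bool_edge: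
  fixes y :: "'a \<Rightarrow> int"
  assumes "finite V" "{a, b} \<subseteq> V" "a \<noteq> b"
  shows "(\<Sum>v\<in>V. y v * of_bool (v \<in> {a, b})) = y a + y b"
proof -
  have "(\<Sum>v\<in>V. y v * of_bool (v \<in> {a, b})) = (\<Sum>v\<in>{a, b}. y v * of_bool (v \<in> {a, b}))"
    using assms by (intro sum.mono_neutral_right) auto
  then show ?thesis using assms(3) by simp
qed

text \<open>Membership in the lattice generated by the indicator vectors of the selected
  edges.\<close>

definition int_combination :: "'a set \<Rightarrow> nat \<Rightarrow> (nat \<Rightarrow> 'a set) \<Rightarrow> ('a \<Rightarrow> int) \<Rightarrow> bool" where
  "int_combination V n g \<phi> \<longleftrightarrow> (\<exists>x. \<forall>v\<in>V. \<phi> v = (\<Sum>k<n. of_bool (v \<in> g k) * x k))"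

lemma int_combination_diff:
  assumes "int_combination V n g \<phi>" "int_combination V n g \<psi>"
  shows "int_combination V n g (\<lambda>v. \<phi> v - \<psi> v)"
proof -
  obtain x y where "\<forall>v\<in>V. \<phi> v = (\<Sum>k<n. of_bool (v \<in> g k) * x k)" "\<forall>v\<in>V. \<psi> v = (\<Sum>k<n. of_bool (v \<in> g k) * y k)"
    using assms by (auto simp: int_combination_def)
  then show ?thesis
    unfolding int_combination_def
    by (intro exI[of _ "\<lambda>k. x k - y k"]) (simp add: right_diff_distrib sum_subtractf)
qed

lemma int_combination_zero: "int_combination V n g (\<lambda>v. 0)"
  unfolding int_combination_def by (rule exI[of _ "\<lambda>k. 0"]) simp

lemma int_combination_generator:
  assumes "k < n"
  shows "int_combination V n g (\<lambda>v. of_bool (v \<in> g k))"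
proof -
  have "(\<Sum>l<n. of_bool (v \<in> g l) * of_bool (l = k)) = (of_bool (v \<in> g k) :: int)" for v
  proof -
    have "(\<Sum>l<n. of_bool (v \<in> g l) * of_bool (l = k)) = (\<Sum>l<n. if l = k then of_bool (v \<in> g k) else 0 :: int)"
      by (intro sum.cong) auto
    then show ?thesis using assms by simp
  qed
  then show ?thesis
    unfolding int_combination_def by (intro exI[of _ "\<lambda>l. of_bool (l = k)"]) simp
qed

text \<open>The alternating sum of the edges along a walk telescopes to its two ends;
  \<open>if p then -1 else 1\<close> is -1 raised to the length of the walk.\<close>

lemma int_combination_parity_walk:
  assumes "parity_walk (g ` {..<n}) p u v" "\<And>k. k < n \<Longrightarrow> card (g k) = 2"
  shows "int_combination V n g (\<lambda>w. of_bool (w = u) - (if p then -1 else 1) * of_bool (w = v))"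
  using assms(1)
proof (induction rule: parity_walk.induct)
  case (refl u)
  then show ?case using int_combination_zero by simp
next
  case (step p u v w)
  then obtain k where k: "k < n" "g k = {v, w}" by auto
  then have vw: "v \<noteq> w" using assms(2)[OF k(1)] by auto
  have gen: "int_combination V n g (\<lambda>x. of_bool (x \<in> {v, w}))"
    using int_combination_generator[OF k(1)] k(2) by metis
  have ib: "of_bool (x \<in> {v, w}) = (of_bool (x = v) + of_bool (x = w) :: int)" for x
    using vw by auto
  show ?case
  proof (cases p)
    case True
    have "(\<lambda>x. of_bool (x = u) - (if p then -1 else 1) * of_bool (x = v) - of_bool (x \<in> {v, w})) =
      (\<lambda>x. of_bool (x = u) - (if \<not> p then -1 else 1) * of_bool (x = w) :: int)"
      unfolding ib using True by (auto simp: fun_eq_iff)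
    with int_combination_diff[OF step.IH gen] show ?thesis by metis
  next
    case False
    \<comment> \<open>Here the edge has to be added. Since closure is available for differences, its
      negative is subtracted.\<close>
    have "(\<lambda>x. of_bool (x = u) - (if p then -1 else 1) * of_bool (x = v) - (0 - of_bool (x \<in> {v, w}))) =
      (\<lambda>x. of_bool (x = u) - (if \<not> p then -1 else 1) * of_bool (x = w) :: int)"
      unfolding ib using False by (auto simp: fun_eq_iff)
    with int_combination_diff[OF step.IH int_combination_diff[OF int_combination_zero gen]]
    show ?thesis by metis
  qed
qed

lemma int_combination_odd_walk:
  assumes "parity_walk (g ` {..<n}) True u v" "u \<noteq> v" "\<And>k. k < n \<Longrightarrow> card (g k) = 2"
  shows "int_combination V n g (\<lambda>w. of_bool (w \<in> {u, v}))"
proof -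
  have "(\<lambda>w. of_bool (w = u) - (if True then -1 else 1) * of_bool (w = v)) = (\<lambda>w. of_bool (w \<in> {u, v}) :: int)"
    using assms(2) by (auto simp: fun_eq_iff)
  with int_combination_parity_walk[OF assms(1,3), of V] show ?thesis by metis
qed

lemma det_edge_matrix_dvd:
  assumes "\<And>j. j < length vs \<Longrightarrow> int_combination (set vs) (length vs) g (\<lambda>v. of_bool (v \<in> h j))"
  shows "det (edge_matrix vs g) dvd det (edge_matrix vs h)"
proof (rule det_dvd_det_if_integer_combinations)
  fix j assume j: "j < length vs"
  obtain x :: "nat \<Rightarrow> int" where "\<forall>v\<in>set vs. of_bool (v \<in> h j) = (\<Sum>k<length vs. of_bool (v \<in> g k) * x k)"
    using assms[OF j] unfolding int_combination_def by blast
  then show "\<exists>x. \<forall>i<length vs. edge_matrix vs h $$ (i, j) = (\<Sum>k<length vs. edge_matrix vs g $$ (i, k) * x k)"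
    using j by (intro exI[of _ x]) simp
qed simp_all

text \<open>Each column of one matrix occurs in the other, so the determinants divide each other.
  This covers reordering without tracking signs of permutations.\<close>

lemma abs_det_edge_matrix_eq:
  assumes "g ` {..<length vs} = h ` {..<length vs}"
  shows "\<bar>det (edge_matrix vs g)\<bar> = \<bar>det (edge_matrix vs h)\<bar>"
proof (rule zdvd_antisym_abs)
  have "int_combination (set vs) (length vs) g (\<lambda>v. of_bool (v \<in> h j))"
    if "g ` {..<length vs} = h ` {..<length vs}" "j < length vs" for g h :: "nat \<Rightarrow> 'a set" and j
  proof -
    have "h j \<in> g ` {..<length vs}" using that by auto
    then obtain k where "k < length vs" "h j = g k" by auto
    then show ?thesis using int_combination_generator by metis
  qed
  with assms show "det (edge_matrix vs g) dvd det (edge_matrix vs h)"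
    and "det (edge_matrix vs h) dvd det (edge_matrix vs g)"
    by (auto intro!: det_edge_matrix_dvd)
qed

section \<open>Maximal minors as determinants of edge selections\<close>

lemma incidence_matrix_carrier [simp]:
  "incidence_matrix vs es \<in> carrier_mat (length vs) (length es)"
  by (simp add: incidence_matrix_def)

lemma dim_incidence_matrix [simp]:
  "dim_row (incidence_matrix vs es) = length vs" "dim_col (incidence_matrix vs es) = length es"
  by (simp_all add: incidence_matrix_def)

lemma submatrix_full_rows:
  assumes J: "J \<subseteq> {..<length es}" "card J = length vs"
  shows "submatrix (incidence_matrix vs es) {..<length vs} J = edge_matrix vs (\<lambda>k. es ! pick J k)"
proof -
  have J_eq: "{j. j < length es \<and> j \<in> J} = J" using J by auto
  have pick_row: "pick {..<length vs} i = i" if "i < length vs" for i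
  proof -
    have "{a \<in> {..<length vs}. a < i} = {..<i}" using that by auto
    then show ?thesis using pick_card_in_set[of i "{..<length vs}"] that by simp
  qed
  have pick_col: "pick J k < length es" if "k < length vs" for k
    using pick_le[of k "length es" J] that J by (simp add: J_eq)
  show ?thesis
    unfolding submatrix_def edge_matrix_def
    using J by (intro eq_matI) (auto simp: J_eq pick_row pick_col incidence_matrix_def)
qed

lemma minors_full_rows:
  assumes "p \<in> minors (incidence_matrix vs es) (length vs)"
  obtains g where "\<And>k. k < length vs \<Longrightarrow> g k \<in> set es" "p = det (edge_matrix vs g)"
proof -
  let ?A = "incidence_matrix vs es"
  obtain I J where IJ: "p = det (submatrix ?A I J)" "I \<subseteq> {..<length vs}" "J \<subseteq> {..<length es}"
    "card I = length vs" "card J = length vs"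
    using assms by (auto simp: minors_def)
  have "I = {..<length vs}" using IJ by (intro card_subset_eq) auto
  then have "p = det (edge_matrix vs (\<lambda>k. es ! pick J k))"
    using IJ submatrix_full_rows by metis
  moreover have "es ! pick J k \<in> set es" if "k < length vs" for k
  proof -
    have "{j. j < length es \<and> j \<in> J} = J" using IJ by auto
    then show ?thesis using pick_le[of k "length es" J] that IJ by simp
  qed
  ultimately show thesis by (intro that[of "\<lambda>k. es ! pick J k"])
qed

text \<open>Nonsingularity makes the selection injective, so the positions of the chosen edges form
  an index set \<open>J\<close> of the right size. The submatrix has the same columns, possibly in
  another order.\<close>

lemma edge_matrix_minor:
  assumes "distinct es" "\<And>k. k < length vs \<Longrightarrow> g k \<in> set es" "det (edge_matrix vs g) \<noteq> 0"
  obtains J where "J \<subseteq> {..<length es}" "card J = length vs"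
    "\<bar>det (submatrix (incidence_matrix vs es) {..<length vs} J)\<bar> = \<bar>det (edge_matrix vs g)\<bar>"
proof -
  let ?n = "length vs"
  have inj: "inj_on g {..<?n}"
  proof (rule inj_onI, rule ccontr)
    fix i j assume ij: "i \<in> {..<?n}" "j \<in> {..<?n}" "g i = g j" "i \<noteq> j"
    then have "col (edge_matrix vs g) i = col (edge_matrix vs g) j"
      by (intro eq_vecI) (auto simp: edge_matrix_def)
    with det_identical_columns[OF edge_matrix_carrier[of vs g] ij(4)] ij assms(3) show False by auto
  qed
  define J where "J = {j \<in> {..<length es}. es ! j \<in> g ` {..<?n}}"
  have img: "(!) es ` J = g ` {..<?n}"
  proof
    show "g ` {..<?n} \<subseteq> (!) es ` J"
    proof
      fix e assume e: "e \<in> g ` {..<?n}"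
      then obtain j where "j < length es" "e = es ! j" using assms(2) by (auto simp: in_set_conv_nth) metis
      with e show "e \<in> (!) es ` J" by (auto simp: J_def)
    qed
  qed (auto simp: J_def)
  have "inj_on ((!) es) J" using assms(1) by (auto simp: J_def inj_on_def nth_eq_iff_index_eq)
  then have "card J = card (g ` {..<?n})" using img card_image by metis
  also have "\<dots> = ?n" using inj by (simp add: card_image)
  finally have J: "J \<subseteq> {..<length es}" "card J = ?n" by (auto simp: J_def)
  have finJ: "finite J" using J(1) finite_subset by blast
  have "j \<in> pick J ` {..<?n}" if "j \<in> J" for j
  proof -
    have "{a \<in> J. a < j} \<subset> J" using that by blast
    then have "card {a \<in> J. a < j} < card J" by (rule psubset_card_mono[OF finJ])
    then have "pick J (card {a \<in> J. a < j}) \<in> pick J ` {..<?n}" unfolding J(2) by blast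
    then show ?thesis unfolding pick_card_in_set[OF that] .
  qed
  then have sub: "J \<subseteq> pick J ` {..<?n}" by blast
  have "card (pick J ` {..<?n}) \<le> card J" using card_image_le[of "{..<?n}" "pick J"] J(2) by simp
  from card_seteq[OF _ sub this] have "pick J ` {..<?n} = J" by simp
  then have "(\<lambda>k. es ! pick J k) ` {..<?n} = g ` {..<?n}" using img by (metis image_image)
  then have "\<bar>det (edge_matrix vs (\<lambda>k. es ! pick J k))\<bar> = \<bar>det (edge_matrix vs g)\<bar>"
    by (rule abs_det_edge_matrix_eq)
  then show thesis using that[OF J] submatrix_full_rows[OF J] by simp
qed

lemma rank_incidence_matrix_full:
  assumes "distinct es" "\<And>k. k < length vs \<Longrightarrow> g k \<in> set es" "det (edge_matrix vs g) \<noteq> 0"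
  shows "int_mat_rank (incidence_matrix vs es) = length vs"
proof -
  let ?A = "incidence_matrix vs es" and ?n = "length vs"
  let ?R = "map_mat rat_of_int ?A"
  obtain J where J: "J \<subseteq> {..<length es}" "card J = ?n"
    "\<bar>det (submatrix ?A {..<?n} J)\<bar> = \<bar>det (edge_matrix vs g)\<bar>"
    using edge_matrix_minor[OF assms] by blast
  have J_eq: "{j. j < length es \<and> j \<in> J} = J" using J by auto
  have R: "?R \<in> carrier_mat ?n (length es)" by simp
  have "submatrix ?R {..<?n} J = map_mat rat_of_int (submatrix ?A {..<?n} J)"
  proof (rule eq_matI)
    fix i j assume "i < dim_row (map_mat rat_of_int (submatrix ?A {..<?n} J))"
      "j < dim_col (map_mat rat_of_int (submatrix ?A {..<?n} J))"
    then have ij: "i < card {i. i < ?n \<and> i \<in> {..<?n}}" "j < card {j. j < length es \<and> j \<in> J}"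
      by (simp_all add: dim_submatrix)
    from pick_le[OF ij(1)] pick_le[OF ij(2)] ij
    show "submatrix ?R {..<?n} J $$ (i, j) = map_mat rat_of_int (submatrix ?A {..<?n} J) $$ (i, j)"
      by (simp add: submatrix_def)
  qed (simp_all add: dim_submatrix)
  then have "det (submatrix ?R {..<?n} J) \<noteq> 0"
    using J(3) assms(3) by (simp add: of_int_hom.hom_det)
  from vec_space.rank_gt_minor[OF R this] have "?n \<le> vec_space.rank ?n ?R"
    using J(2) by (simp add: J_eq)
  with vec_space.rank_le_nr[OF R] show ?thesis by (simp add: int_mat_rank_def)
qed

text \<open>A nonsingular selection is a minor up to sign, and its existence makes the rank equal to
  \<open>length vs\<close>, the size of minors that \<open>unimodular\<close> then compares.\<close>

lemma unimodular_edge_matrix: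
  assumes "unimodular (incidence_matrix vs es)" "distinct es"
    and "\<And>k. k < length vs \<Longrightarrow> g k \<in> set es" "\<And>k. k < length vs \<Longrightarrow> h k \<in> set es"
    and "det (edge_matrix vs g) \<noteq> 0" "det (edge_matrix vs h) \<noteq> 0"
  shows "\<bar>det (edge_matrix vs g)\<bar> = \<bar>det (edge_matrix vs h)\<bar>"
proof -
  let ?A = "incidence_matrix vs es"
  have "\<exists>p\<in>minors ?A (length vs). \<bar>p\<bar> = \<bar>det (edge_matrix vs f)\<bar>"
    if f: "\<And>k. k < length vs \<Longrightarrow> f k \<in> set es" "det (edge_matrix vs f) \<noteq> 0" for f
  proof -
    obtain J where J: "J \<subseteq> {..<length es}" "card J = length vs"
      "\<bar>det (submatrix ?A {..<length vs} J)\<bar> = \<bar>det (edge_matrix vs f)\<bar>"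
      using edge_matrix_minor[OF assms(2) f] by blast
    have "det (submatrix ?A {..<length vs} J) \<in> minors ?A (length vs)"
      unfolding minors_def mem_Collect_eq
      by (rule exI[of _ "{..<length vs}"], rule exI[of _ J]) (use J in simp)
    with J(3) show ?thesis by blast
  qed
  from this[OF assms(3,5)] this[OF assms(4,6)] show ?thesis
    using assms(1,5,6) rank_incidence_matrix_full[OF assms(2,3,5)]
    unfolding unimodular_def by (metis abs_eq_0)
qed

text \<open>A vector orthogonal to all columns of \<open>S\<close> is a vertex weighting with
  opposite values at the ends of each edge; \<open>ker\<close> says that only the zero weighting is
  of this kind.\<close>

lemma obtain_nonsingular_edges:
  fixes vs :: "'a list"
  assumes "distinct vs" "finite S" "\<And>e. e \<in> S \<Longrightarrow> e \<subseteq> set vs \<and> card e = 2"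
    and ker: "\<And>y :: 'a \<Rightarrow> int. (\<And>u v. {u, v} \<in> S \<Longrightarrow> y u + y v = 0) \<Longrightarrow> \<forall>v\<in>set vs. y v = 0"
  obtains g where "\<And>k. k < length vs \<Longrightarrow> g k \<in> S" "det (edge_matrix vs g) \<noteq> 0"
proof -
  let ?n = "length vs"
  let ?a = "\<lambda>e. vec ?n (\<lambda>i. of_bool (vs ! i \<in> e)) :: int vec"
  have "y = 0\<^sub>v ?n" if y: "y \<in> carrier_vec ?n" "\<forall>e\<in>S. ?a e \<bullet> y = 0" for y
  proof -
    \<comment> \<open>The inverse of the enumeration \<open>vs\<close> turns the vector
      \<open>y\<close> into a function \<open>z\<close> on vertices.\<close>
    obtain ix where ix: "\<And>i. i < ?n \<Longrightarrow> ix (vs ! i) = i"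
      using assms(1) by (metis inj_on_nth lessThan_iff inv_into_f_f[of "(!) vs" "{..<length vs}"])
    define z where "z v = y $ ix v" for v
    have "\<forall>v\<in>set vs. z v = 0"
    proof (rule ker)
      fix u v assume uv: "{u, v} \<in> S"
      then have uv': "{u, v} \<subseteq> set vs" "u \<noteq> v" using assms(3)[OF uv] by auto
      have "0 = ?a {u, v} \<bullet> y" by (rule bspec[OF y(2) uv, symmetric])
      also have "\<dots> = (\<Sum>i<?n. z (vs ! i) * of_bool (vs ! i \<in> {u, v}))"
        using y(1) by (simp add: scalar_prod_def lessThan_atLeast0 z_def ix mult.commute)
      also have "\<dots> = (\<Sum>v'\<in>set vs. z v' * of_bool (v' \<in> {u, v}))"
        by (rule sum_nth_distinct[OF assms(1)])
      also have "\<dots> = z u + z v" using uv' by (intro sum_of_bool_edge) auto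
      finally show "z u + z v = 0" by simp
    qed
    then show ?thesis using y(1) ix by (intro eq_vecI) (auto simp: z_def all_set_conv_all_nth)
  qed
  then obtain g where g: "\<And>k. k < ?n \<Longrightarrow> g k \<in> S" "det (mat\<^sub>r ?n ?n (\<lambda>k. ?a (g k))) \<noteq> 0"
    using obtain_nonsingular_selection[OF assms(2), of ?a ?n] by auto
  have "mat\<^sub>r ?n ?n (\<lambda>k. ?a (g k)) = (edge_matrix vs g)\<^sup>T"
    by (intro eq_matI) (auto simp: edge_matrix_def)
  with g(2) have "det (edge_matrix vs g) \<noteq> 0" using det_transpose[of "edge_matrix vs g" ?n] by simp
  with g(1) that show thesis by blast
qed

text \<open>Without such a walk, the parity of walks from \<open>r\<close> gives consistent signs on
  the component of \<open>r\<close>. Extended by 0 to the other vertices, they form a nonzero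
  combination of the rows that vanishes in every column.\<close>

lemma nonsingular_imp_odd_closed_walk:
  assumes "distinct vs" and g: "\<And>k. k < length vs \<Longrightarrow> g k \<subseteq> set vs \<and> card (g k) = 2"
    and "det (edge_matrix vs g) \<noteq> 0" and "r \<in> set vs"
  shows "parity_walk (g ` {..<length vs}) True r r"
proof (rule ccontr)
  let ?W = "parity_walk (g ` {..<length vs})"
  assume no: "\<not> ?W True r r"
  define s :: "'a \<Rightarrow> int" where "s v = (if ?W False r v then 1 else if ?W True r v then -1 else 0)" for v
  have excl: "\<not> (?W True r v \<and> ?W False r v)" for v
    using no parity_walk_trans[OF parity_walk_sym[of _ True r v], of _ False r] by auto
  obtain i where i: "i < length vs" "vs ! i = r" using assms(4) by (auto simp: in_set_conv_nth)
  have "(\<Sum>i<length vs. s (vs ! i) * edge_matrix vs g $$ (i, k)) = 0" if k: "k < length vs" for k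
  proof -
    obtain u v where uv: "g k = {u, v}" "u \<noteq> v" "{u, v} \<subseteq> set vs"
      using g[OF k] by (auto simp: card_2_iff)
    have "(\<Sum>i<length vs. s (vs ! i) * edge_matrix vs g $$ (i, k)) =
      (\<Sum>i<length vs. s (vs ! i) * of_bool (vs ! i \<in> {u, v}))"
      using k uv(1) by (intro sum.cong) auto
    also have "\<dots> = (\<Sum>w\<in>set vs. s w * of_bool (w \<in> {u, v}))"
      by (rule sum_nth_distinct[OF assms(1)])
    also have "\<dots> = s u + s v" using uv by (intro sum_of_bool_edge) auto
    also have "\<dots> = 0"
    proof -
      have "?W True u v" using k uv(1) by (intro parity_walk_edge) force
      then have "?W True r v \<longleftrightarrow> ?W False r u" "?W False r v \<longleftrightarrow> ?W True r u"
        using parity_walk_trans[of _ True u v True r] parity_walk_trans[of _ True u v False r]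
          parity_walk_trans[of _ True v u True r] parity_walk_trans[of _ True v u False r]
          parity_walk_sym[of _ True u v] by auto
      then show ?thesis using excl[of u] by (auto simp: s_def)
    qed
    finally show ?thesis .
  qed
  moreover have "s (vs ! i) \<noteq> 0" using i by (simp add: s_def parity_walk.refl)
  ultimately have "det (edge_matrix vs g) = 0"
    by (intro det_zero_if_left_kernel[OF edge_matrix_carrier, of vs "\<lambda>i. s (vs ! i)" g i] i(1))
  with assms(3) show False ..
qed

section \<open>Unimodularity and disjoint odd cycles\<close>

context simple_graph
begin

context
  fixes vs :: "'a list" and es :: "'a set list"
  assumes vs: "distinct vs" "set vs = verts G" and es: "distinct es" "set es = edges G"
begin

text \<open>The bound on minors holds in every size, so the rank need not be computed.\<close>

lemma unimodular_if_bipartite: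
  assumes "bipartite G"
  shows "unimodular (incidence_matrix vs es)"
proof -
  let ?A = "incidence_matrix vs es"
  obtain X Y where XY: "X \<union> Y = verts G" "X \<inter> Y = {}"
    "\<forall>e\<in>edges G. \<exists>x\<in>X. \<exists>y\<in>Y. e = {x, y}"
    using assms by (auto simp: bipartite_def)
  have "\<bar>p\<bar> \<le> 1" if p: "p \<in> minors ?A d" for p d
  proof -
    obtain I J where IJ: "p = det (submatrix ?A I J)" "I \<subseteq> {..<length vs}" "J \<subseteq> {..<length es}"
      "card I = d" "card J = d"
      using p by (auto simp: minors_def)
    have I_eq: "{i. i < length vs \<and> i \<in> I} = I" and J_eq: "{j. j < length es \<and> j \<in> J} = J"
      using IJ by auto
    have entry: "submatrix ?A I J $$ (i, j) = (if vs ! pick I i \<in> es ! pick J j then 1 else 0)"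
      and pick_less: "pick I i < length vs" "pick J j < length es" if "i < d" "j < d" for i j
      using that pick_le[of i "length vs" I] pick_le[of j "length es" J] IJ
      by (auto simp: submatrix_def I_eq J_eq incidence_matrix_def)
    show ?thesis
      unfolding IJ(1)
    proof (rule abs_det_le_1_if_two_coloured[where t = "\<lambda>i. vs ! pick I i \<in> X"])
      show "submatrix ?A I J \<in> carrier_mat d d"
        using IJ by (intro carrier_matI) (simp_all add: dim_submatrix I_eq J_eq)
      show "submatrix ?A I J $$ (i, j) \<in> {0, 1}" if "i < d" "j < d" for i j
        using entry[OF that] by simp
      fix i i' j
      assume ij: "i < d" "i' < d" "j < d" "submatrix ?A I J $$ (i, j) \<noteq> 0" "submatrix ?A I J $$ (i', j) \<noteq> 0"
        and col: "(vs ! pick I i \<in> X) = (vs ! pick I i' \<in> X)"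
      have mem: "vs ! pick I i \<in> es ! pick J j" "vs ! pick I i' \<in> es ! pick J j"
        using ij entry by (auto split: if_splits)
      have "es ! pick J j \<in> edges G" using pick_less[OF ij(1,3)] es(2) nth_mem by blast
      then obtain x y where "x \<in> X" "y \<in> Y" "es ! pick J j = {x, y}" using XY(3) by blast
      with mem col XY(2) have "vs ! pick I i = vs ! pick I i'" by auto
      then have eq: "pick I i = pick I i'"
        using vs(1) pick_less ij by (simp add: nth_eq_iff_index_eq)
      \<comment> \<open>An index is recovered from its pick as the number of smaller elements of
        \<open>I\<close>.\<close>
      have "card {a \<in> I. a < pick I i} = i" "card {a \<in> I. a < pick I i'} = i'"
        using ij(1,2) IJ(4) by (auto intro!: card_pick)
      then show "i = i'" unfolding eq by simp
    qed
  qed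
  note le = this
  have "\<bar>p\<bar> = 1" if "p \<in> minors ?A d" "p \<noteq> 0" for p d
    using le[OF that(1)] that(2) by linarith
  then show ?thesis by (simp add: unimodular_def)
qed

lemma unimodular_if_strong_odd_cycle_property:
  assumes socp: "strong_odd_cycle_property G" and "linked G" and nonbip: "\<not> bipartite G"
  shows "unimodular (incidence_matrix vs es)"
proof -
  let ?A = "incidence_matrix vs es" and ?n = "length vs"
  obtain c where c: "odd_cycle G c" using nonbip bipartite_iff_no_odd_cycle[OF edge_simple] by blast
  then obtain r where r: "r \<in> set c" by (cases c) (auto simp: odd_cycle_def)
  then have rG: "r \<in> verts G" using c by (auto simp: odd_cycle_def is_cycle_def)
  \<comment> \<open>Such a \<open>y\<close> changes sign along every edge. The odd closed walk at
    \<open>r\<close> forces \<open>y r = - y r\<close>, and connectedness carries the zero to all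
    vertices.\<close>
  have ker: "\<forall>v\<in>set vs. y v = 0" if y: "\<And>u v. {u, v} \<in> edges G \<Longrightarrow> y u + y v = 0" for y :: "'a \<Rightarrow> int"
  proof -
    have alt: "y v = (if p then - y u else y u)" if "parity_walk (edges G) p u v" for p u v
      using that
    proof (induction rule: parity_walk.induct)
      case (step p u v w)
      then show ?case using y[of v w] by auto
    qed simp
    have "y r = 0" using alt[OF odd_cycle_parity_walk[OF c r]] by simp
    moreover have "\<exists>p. parity_walk (edges G) p r v" if "v \<in> verts G" for v
      using \<open>linked G\<close> rG that unfolding linked_def rtranclp_adjacent_iff_parity_walk by blast
    ultimately show ?thesis using alt[of _ r] vs(2) by (metis neg_0_equal_iff_equal)
  qed
  have simple: "e \<subseteq> set vs \<and> card e = 2" if "e \<in> edges G" for e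
    using that edge_simple vs(2) by auto
  obtain g0 where g0: "\<And>k. k < ?n \<Longrightarrow> g0 k \<in> edges G" "det (edge_matrix vs g0) \<noteq> 0"
    using obtain_nonsingular_edges[OF vs(1) finite_edges simple ker] by blast
  have rank: "int_mat_rank ?A = ?n"
    using rank_incidence_matrix_full[OF es(1), of vs g0] g0 es(2) by blast
  have dvd: "det (edge_matrix vs g) dvd det (edge_matrix vs h)"
    if g: "\<And>k. k < ?n \<Longrightarrow> g k \<in> edges G" "det (edge_matrix vs g) \<noteq> 0"
      and h: "\<And>k. k < ?n \<Longrightarrow> h k \<in> edges G" for g h
  proof (rule det_edge_matrix_dvd)
    \<comment> \<open>Each component of the spanning subgraph of selected edges contains an odd
      cycle. These are odd cycles of \<open>G\<close> and meet pairwise, so there is only one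
      component.\<close>
    let ?H = "\<lparr>verts = verts G, edges = g ` {..<?n}\<rparr>"
    let ?W = "parity_walk (g ` {..<?n})"
    have gs: "g k \<subseteq> set vs \<and> card (g k) = 2" if "k < ?n" for k using g(1) simple that by blast
    have oddW: "?W True w w" if "w \<in> set vs" for w
      using nonsingular_imp_odd_closed_walk[OF vs(1) gs g(2) that] by blast
    have Hs: "\<forall>e\<in>edges ?H. e \<subseteq> verts ?H \<and> card e = 2" using gs vs(2) by auto
    have sub: "edges ?H \<subseteq> edges G" using g(1) by auto
    have cyc: "\<exists>d. odd_cycle G d \<and> (\<forall>x\<in>set d. \<exists>q. ?W q w x)" if "w \<in> set vs" for w
    proof -
      obtain d where d: "odd_cycle ?H d" "\<forall>x\<in>set d. \<exists>q. ?W q w x"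
        using parity_walk_contains_odd_cycle[OF Hs, of w] oddW[OF \<open>w \<in> set vs\<close>] by auto
      then have "odd_cycle G d" using sub by (auto simp: odd_cycle_def is_cycle_def adjacent_def)
      with d(2) show ?thesis by blast
    qed
    fix j assume j: "j < ?n"
    obtain u v where uv: "h j = {u, v}" "u \<noteq> v" "{u, v} \<subseteq> set vs"
      using simple[OF h[OF j]] by (auto simp: card_2_iff)
    obtain du dv where "odd_cycle G du" "\<forall>x\<in>set du. \<exists>q. ?W q u x"
      "odd_cycle G dv" "\<forall>x\<in>set dv. \<exists>q. ?W q v x"
      using cyc[of u] cyc[of v] uv(3) by auto
    moreover from this obtain x where "x \<in> set du" "x \<in> set dv"
      using socp unfolding strong_odd_cycle_property_def by blast
    ultimately obtain p q where "?W p u x" "?W q v x" by blast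
    then have "?W (p \<noteq> q) u v" using parity_walk_trans[OF parity_walk_sym] by metis
    \<comment> \<open>If the walk found from \<open>u\<close> to \<open>v\<close> is even, an odd
      closed walk at \<open>v\<close> corrects its parity.\<close>
    moreover have "?W True v v" using oddW uv(3) by simp
    ultimately have "?W True u v"
      using parity_walk_trans[of _ True v v "p \<noteq> q" u] by (cases "p \<noteq> q") auto
    then show "int_combination (set vs) ?n g (\<lambda>w. of_bool (w \<in> h j))"
      unfolding uv(1) using uv(2) gs by (intro int_combination_odd_walk) auto
  qed
  show ?thesis
    unfolding unimodular_def rank
  proof (intro ballI impI)
    fix p q assume pq: "p \<in> minors ?A ?n" "q \<in> minors ?A ?n" "p \<noteq> 0 \<and> q \<noteq> 0"
    obtain g where g: "\<And>k. k < ?n \<Longrightarrow> g k \<in> set es" "p = det (edge_matrix vs g)"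
      using minors_full_rows[OF pq(1)] by blast
    obtain h where h: "\<And>k. k < ?n \<Longrightarrow> h k \<in> set es" "q = det (edge_matrix vs h)"
      using minors_full_rows[OF pq(2)] by blast
    show "\<bar>p\<bar> = \<bar>q\<bar>"
      using dvd[of g h] dvd[of h g] g h pq(3) es(2) by (intro zdvd_antisym_abs) auto
  qed
qed

lemma strong_odd_cycle_property_if_unimodular:
  assumes uni: "unimodular (incidence_matrix vs es)" and linked: "linked G"
  shows "strong_odd_cycle_property G"
  unfolding strong_odd_cycle_property_def
proof (intro allI impI notI)
  fix c d assume "odd_cycle G c \<and> odd_cycle G d" and disj: "set c \<inter> set d = {}"
  then have c: "odd_cycle G c" and d: "odd_cycle G d" by auto
  let ?n = "length vs"
  \<comment> \<open>\<open>V1\<close> will be what \<open>c\<close> reaches without touching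
    \<open>d\<close>, so it contains \<open>c\<close> and misses \<open>d\<close>. \<open>S\<close>
    omits exactly the edges between \<open>V1\<close> and its complement.\<close>
  define E' where "E' = {e \<in> edges G. e \<inter> set d = {}}"
  define V1 where "V1 = {v. \<exists>u\<in>set c. \<exists>p. parity_walk E' p u v}"
  define S where "S = {e \<in> edges G. e \<subseteq> V1 \<or> e \<inter> V1 = {}}"
  have cV1: "set c \<subseteq> V1" by (auto simp: V1_def intro: parity_walk.refl)
  have dV1: "set d \<inter> V1 = {}"
  proof -
    have "v \<notin> set d" if "parity_walk E' p u v" "u \<notin> set d" for p u v
      using that by (induction rule: parity_walk.induct) (auto simp: E'_def)
    then show ?thesis using disj by (auto simp: V1_def)
  qed
  have V1_step: "w \<in> V1" if "v \<in> V1" "{v, w} \<in> E'" for v w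
    using that parity_walk.step unfolding V1_def by fast
  have SG: "S \<subseteq> edges G" by (auto simp: S_def)
  have simple: "e \<subseteq> set vs \<and> card e = 2" if "e \<in> S" for e
    using that SG edge_simple vs(2) by blast
  have ker: "\<forall>v\<in>set vs. y v = 0" if y: "\<And>u v. {u, v} \<in> S \<Longrightarrow> y u + y v = 0" for y :: "'a \<Rightarrow> int"
  proof -
    have alt: "y v = (if p then - y u else y u)" if "parity_walk S p u v" for p u v
      using that
    proof (induction rule: parity_walk.induct)
      case (step p u v w)
      then show ?case using y[of v w] by auto
    qed simp
    have yc: "y v = 0" if "v \<in> set c" for v
    proof -
      have "parity_walk S True v v"
        by (rule odd_cycle_parity_walk[OF c that]) (use cV1 in \<open>auto simp: S_def\<close>)
      then show ?thesis using alt[of True v v] by simp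
    qed
    have yd: "y v = 0" if "v \<in> set d" for v
    proof -
      have "parity_walk S True v v"
        by (rule odd_cycle_parity_walk[OF d that]) (use dV1 in \<open>auto simp: S_def\<close>)
      then show ?thesis using alt[of True v v] by simp
    qed
    have yV1: "y v = 0" if "v \<in> V1" for v
    proof -
      obtain u p where "parity_walk E' p u v" "u \<in> set c" using \<open>v \<in> V1\<close> by (auto simp: V1_def)
      then show ?thesis
      proof (induction rule: parity_walk.induct)
        case (refl u)
        then show ?case using yc by simp
      next
        case (step p u v w)
        then have "v \<in> V1" by (auto simp: V1_def)
        then have "{v, w} \<subseteq> V1" using V1_step step.hyps by auto
        then have "{v, w} \<in> S" using step.hyps by (auto simp: S_def E'_def)
        then show ?case using y[of v w] step by simp
      qed
    qed
    \<comment> \<open>A path from \<open>v\<close> to \<open>c\<close> is read backwards. From a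
      vertex outside \<open>V1\<close> and \<open>d\<close> it cannot step into \<open>V1\<close>,
      so that step is an edge of \<open>S\<close> and carries the zero back.\<close>
    have "y v = 0" if "v \<in> verts G" for v
    proof -
      obtain u where u: "u \<in> set c" using c by (cases c) (auto simp: odd_cycle_def)
      then have "u \<in> verts G" using c by (auto simp: odd_cycle_def is_cycle_def)
      then have "rtranclp (adjacent G) v u" using linked that by (auto simp: linked_def)
      then show ?thesis
      proof (induction rule: converse_rtranclp_induct)
        case base
        then show ?case using yc u by blast
      next
        case (step v w)
        show ?case
        proof (cases "v \<in> V1 \<or> v \<in> set d")
          case True
          then show ?thesis using yV1 yd by blast
        next
          case False
          have vw: "{v, w} \<in> edges G" using step.hyps by (simp add: adjacent_def)
          show ?thesis
          proof (cases "w \<in> V1")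
            case True
            then have "w \<notin> set d" using dV1 by blast
            then have "{w, v} \<in> E'" using vw False by (auto simp: E'_def insert_commute)
            then show ?thesis using V1_step True False by blast
          next
            case wV1: False
            then have "{v, w} \<in> S" using vw False by (auto simp: S_def)
            then show ?thesis using y[of v w] step.IH by simp
          qed
        qed
      qed
    qed
    then show ?thesis using vs(2) by blast
  qed
  obtain g where g: "\<And>k. k < ?n \<Longrightarrow> g k \<in> S" "det (edge_matrix vs g) \<noteq> 0"
    using obtain_nonsingular_edges[OF vs(1) finite_subset[OF SG finite_edges] simple ker] by blast
  have gE: "g k \<in> set es" if "k < ?n" for k using g(1)[OF that] SG es(2) by blast
  \<comment> \<open>A path from \<open>c\<close> to \<open>d\<close> has to leave
    \<open>V1\<close>.\<close>
  obtain a b where ab: "a \<in> V1" "b \<notin> V1" "{a, b} \<in> edges G"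
  proof -
    obtain u v where uv: "u \<in> set c" "v \<in> set d" using c d by (cases c; cases d) (auto simp: odd_cycle_def)
    then have "u \<in> verts G" "v \<in> verts G" using c d by (auto simp: odd_cycle_def is_cycle_def)
    then have "rtranclp (adjacent G) u v" using linked by (simp add: linked_def)
    then have "v \<in> V1 \<or> (\<exists>a b. a \<in> V1 \<and> b \<notin> V1 \<and> {a, b} \<in> edges G)"
      by (induction rule: rtranclp_induct) (use uv cV1 in \<open>auto simp: adjacent_def\<close>)
    then show thesis using that uv dV1 by blast
  qed
  let ?D = "det (edge_matrix vs g)"
  let ?x = "\<lambda>k. det (edge_matrix vs (g(k := {a, b})))"
  \<comment> \<open>By unimodularity each \<open>?x k\<close> is 0 or plus or minus
    \<open>?D\<close>, so the Cramer coefficients \<open>z k\<close> are integers.\<close>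
  define z where "z k = ?x k div ?D" for k
  have z: "?x k = ?D * z k" if k: "k < ?n" for k
  proof (cases "?x k = 0")
    case False
    have "\<bar>?D\<bar> = \<bar>?x k\<bar>"
      by (rule unimodular_edge_matrix[OF uni es(1)]) (use gE ab(3) es(2) g(2) False in auto)
    then have "?D dvd ?x k" by (metis abs_dvd_iff dvd_abs_iff dvd_refl)
    then show ?thesis by (simp add: z_def)
  qed (simp add: z_def)
  have combo: "(\<Sum>k<?n. of_bool (vs ! i \<in> g k) * z k) = of_bool (vs ! i \<in> {a, b})" if i: "i < ?n" for i
  proof -
    let ?b = "vec ?n (\<lambda>i. of_bool (vs ! i \<in> {a, b})) :: int vec"
    have "replace_col (edge_matrix vs g) ?b k = edge_matrix vs (g(k := {a, b}))" if "k < ?n" for k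
      by (intro eq_matI) (auto simp: replace_col_def edge_matrix_def)
    then have "?D * of_bool (vs ! i \<in> {a, b}) = (\<Sum>k<?n. of_bool (vs ! i \<in> g k) * ?x k)"
      using cramer_integral[of "edge_matrix vs g" ?n ?b i] i by simp
    also have "\<dots> = ?D * (\<Sum>k<?n. of_bool (vs ! i \<in> g k) * z k)"
      unfolding sum_distrib_left using z by (intro sum.cong) auto
    finally show ?thesis using g(2) by (simp only: mult_cancel_left) auto
  qed
  have vset: "(\<Sum>k<?n. of_bool (v \<in> g k) * z k) = of_bool (v \<in> {a, b})" if "v \<in> set vs" for v
    using combo that by (metis in_set_conv_nth)
  have abV: "a \<in> set vs" "b \<in> set vs" "a \<noteq> b" using ab edge_simple vs(2) by auto
  \<comment> \<open>Weighing vertices by membership in \<open>V1\<close>, every edge of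
    \<open>S\<close> gets 0 or 2, whereas the crossing edge gets 1. This contradicts the integer
    combination in \<open>vset\<close>.\<close>
  have weight: "(\<Sum>v\<in>set vs. of_bool (v \<in> V1) * of_bool (v \<in> {u, w})) = (of_bool (u \<in> V1) + of_bool (w \<in> V1) :: int)"
    if "{u, w} \<subseteq> set vs" "u \<noteq> w" for u w
    using that sum_of_bool_edge[of "set vs" u w "\<lambda>v. of_bool (v \<in> V1)"] by simp
  have "even (\<Sum>v\<in>set vs. of_bool (v \<in> V1) * of_bool (v \<in> g k) :: int)" if k: "k < ?n" for k
  proof -
    obtain u w where uw: "g k = {u, w}" "u \<noteq> w" "{u, w} \<subseteq> set vs"
      using simple[OF g(1)[OF k]] by (auto simp: card_2_iff)
    have "u \<in> V1 \<longleftrightarrow> w \<in> V1" using g(1)[OF k] uw(1) by (auto simp: S_def)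
    then show ?thesis unfolding uw(1) weight[OF uw(3,2)] by simp
  qed
  then have "even (\<Sum>k<?n. (\<Sum>v\<in>set vs. of_bool (v \<in> V1) * of_bool (v \<in> g k)) * z k)"
    by - (rule dvd_sum, rule dvd_mult2, simp only: lessThan_iff)
  also have "(\<Sum>k<?n. (\<Sum>v\<in>set vs. of_bool (v \<in> V1) * of_bool (v \<in> g k)) * z k) =
    (\<Sum>v\<in>set vs. of_bool (v \<in> V1) * (\<Sum>k<?n. of_bool (v \<in> g k) * z k))"
    unfolding sum_distrib_left sum_distrib_right mult.assoc by (rule sum.swap)
  also have "\<dots> = (\<Sum>v\<in>set vs. of_bool (v \<in> V1) * of_bool (v \<in> {a, b}))"
    using vset by (intro sum.cong) auto
  also have "\<dots> = 1" using weight[of a b] abV ab by simp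
  finally show False by simp
qed

end

end

theorem theorem3p13:
  fixes G :: "'a ugraph"
    and vs :: "'a list"
    and es :: "'a set list"
  assumes "finite_simple_graph G"
    and "connected_graph G"
    and "distinct vs" and "set vs = verts G"
    and "distinct es" and "set es = edges G"
  shows "toric_ideal_unimodular vs es \<longleftrightarrow>
    exactly_one_of
      (\<forall>B\<in>blocks G. bipartite B)
      (\<exists>B\<in>blocks G. \<not> bipartite B \<and> (\<forall>B'\<in>blocks G. B' \<noteq> B \<longrightarrow> bipartite B') \<and>
         strong_odd_cycle_property B)
      (\<exists>s\<ge>2. card {B \<in> blocks G. \<not> bipartite B} = s \<and> (\<exists>x. link_vertex G x))"
proof -
  interpret simple_graph G using assms(1) by unfold_locales
  have "linked G" using assms(2) connected_graph_iff[OF finite_verts] by blast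
  \<comment> \<open>In one direction, bipartite and non-bipartite \<open>G\<close> are treated by
    different lemmas.\<close>
  then have "toric_ideal_unimodular vs es \<longleftrightarrow> strong_odd_cycle_property G"
    unfolding toric_ideal_unimodular_def
    using unimodular_if_bipartite[OF assms(3-6)] unimodular_if_strong_odd_cycle_property[OF assms(3-6)]
      strong_odd_cycle_property_if_unimodular[OF assms(3-6)] by blast
  then show ?thesis using strong_odd_cycle_property_iff_blocks by simp
qed

end
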